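(* Let $(\mathsf{A},\Delta)$ be a compact quantum group whose Haar state $h$ is faithful on $\mathsf{A}$, with dense Hopf $*$-algebra $\mathcal{A}$. Let $\phi\in\mathcal{A}'$ be a GNS-symmetric generating functional with associated Schürmann triple $((\pi,H_\pi),\eta,\phi)$, let $L_\phi=(\mathrm{id}\otimes\phi)\circ\Delta$ on $\mathcal{A}$, and let $H_\phi$ and $\mathcal{E}_\phi$ be the associated operator and Dirichlet form on $L^2(\mathsf{A},h)$. Then the operator $d:D(d)\to L^2(\mathsf{A},h)\otimes H_\pi$ defined by $$D(d):=i_h(\mathcal{A})=\mathcal{A}\xi_h\subset L^2(\mathsf{A},h),\qquad d(i_h(a)):=\partial a=a_{(1)}\xi_h\otimes\eta(a_{(2)}),\quad a\in\mathcal{A},$$ is closable, and $$\|d(i_h(a))\|^2_{L^2(\mathsf{A},h)\otimes H_\pi}=2\langle i_h(a),H_\phi i_h(a)\rangle_{L^2(\mathsf{A},h)}=2\,\mathcal{E}_\phi[i_h(a)],\qquad a\in\mathcal{A}.$$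
   Context: $\mathcal{A}\subseteq\mathsf{A}$ is the dense Hopf $*$-algebra spanned by coefficients of finite-dimensional unitary corepresentations, with counit $\varepsilon$ and antipode $S$. $h$ is the Haar state, $L^2(\mathsf{A},h)$ its GNS space with cyclic vector $\xi_h$, and $i_h(a)=a\xi_h$. Sweedler notation $\Delta(a)=a_{(1)}\otimes a_{(2)}$ is used. A generating functional of a Lévy process is a hermitian linear functional $\phi$ on $\mathcal{A}$ with $\phi(1)=0$ and $\phi(a^*a)\ge0$ for $a\in\ker\varepsilon$; it is GNS-symmetric if $\phi\circ S=\phi$. Its associated Schürmann triple $((\pi,H_\pi),\eta,\phi)$ (unique up to unitary equivalence) consists of a unital $*$-representation $\pi:\mathcal{A}\to B(H_\pi)$ on a Hilbert space, a linear map $\eta:\mathcal{A}\to H_\pi$ with dense image satisfying $\eta(ab)=\pi(a)\eta(b)+\eta(a)\varepsilon(b)$, and $\phi$ with $\phi(ab)=\langle\eta(a^* ),\eta(b)\rangle$ for $a,b\in\ker\varepsilon$. $H_\phi$ and $\mathcal{E}_\phi$: let $\sigma_z$ be the modular group of $h$ on $\mathcal{A}$ (so $h(ab)=h(b\sigma_{-i}(a))$) and $i_s(a)=\sigma_{-i/4}(a)\xi_h$; then $H_\phi i_s(a)=-i_s(L_\phi(a))$ on $i_s(\mathcal{A})=\mathcal{A}\xi_h$, and $\mathcal{E}_\phi[\xi]=\langle\xi,H_\phi\xi\rangle$ for $\xi\in\mathcal{A}\xi_h$ (both extended by closure). In the GNS-symmetric case $L_\phi$ commutes with $\sigma_z$,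 so equivalently $H_\phi(a\xi_h)=-L_\phi(a)\xi_h$ and $\mathcal{E}_\phi[a\xi_h]=-h(a^*L_\phi(a))$ for $a\in\mathcal{A}$. *)

theory Defs
  imports "HOL-Analysis.Analysis"
begin

section \<open>Complex normed spaces, Hilbert spaces, unital C*-algebras\<close>

class complex_normed_vector = real_normed_vector +
  fixes scaleC :: "complex \<Rightarrow> 'a \<Rightarrow> 'a"  (infixr "*\<^sub>C" 75)
  assumes scaleC_add_right: "c *\<^sub>C (x + y) = c *\<^sub>C x + c *\<^sub>C y"
    and scaleC_add_left: "(c + c') *\<^sub>C x = c *\<^sub>C x + c' *\<^sub>C x"
    and scaleC_scaleC: "c *\<^sub>C c' *\<^sub>C x = (c * c') *\<^sub>C x"
    and scaleC_of_real: "complex_of_real r *\<^sub>C x = r *\<^sub>R x"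
    and norm_scaleC: "norm (c *\<^sub>C x) = cmod c * norm x"

instantiation complex :: complex_normed_vector
begin
definition scaleC_complex :: "complex \<Rightarrow> complex \<Rightarrow> complex" where
  "scaleC_complex c x = c * x"
instance
  by standard (auto simp: scaleC_complex_def algebra_simps scaleR_conv_of_real norm_mult)
end

text \<open>Inner products are linear in the second argument.\<close>

class chilbert_space = complex_normed_vector + banach +
  fixes cinner :: "'a \<Rightarrow> 'a \<Rightarrow> complex"
  assumes cinner_commute: "cinner x y = cnj (cinner y x)"
    and cinner_add_right: "cinner x (y + z) = cinner x y + cinner x z"
    and cinner_scaleC_right: "cinner x (c *\<^sub>C y) = c * cinner x y"
    and cinner_self: "cinner x x = complex_of_real ((norm x)\<^sup>2)"

class cstar_algebra = complex_normed_vector + real_normed_algebra_1 + banach +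
  fixes star :: "'a \<Rightarrow> 'a"
  assumes mult_scaleC_left: "(c *\<^sub>C x) * y = c *\<^sub>C (x * y)"
    and mult_scaleC_right: "x * (c *\<^sub>C y) = c *\<^sub>C (x * y)"
    and star_add: "star (x + y) = star x + star y"
    and star_scaleC: "star (c *\<^sub>C x) = cnj c *\<^sub>C star x"
    and star_mult: "star (x * y) = star y * star x"
    and star_star: "star (star x) = x"
    and cstar_identity: "norm (star x * x) = (norm x)\<^sup>2"

abbreviation cspan :: "'a::complex_normed_vector set \<Rightarrow> 'a set" where
  "cspan \<equiv> module.span scaleC"

abbreviation csubspace :: "'a::complex_normed_vector set \<Rightarrow> bool" where
  "csubspace \<equiv> module.subspace scaleC"

abbreviation cindependent :: "'a::complex_normed_vector set \<Rightarrow> bool" where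
  "cindependent S \<equiv> \<not> module.dependent scaleC S"

text \<open>Maps on the dense Hopf algebra are total functions on the ambient C*-algebra; only their
  values on the subspace \<open>M\<close> matter.\<close>

definition clinear_on ::
    "'a::complex_normed_vector set \<Rightarrow> ('a \<Rightarrow> 'b::complex_normed_vector) \<Rightarrow> bool" where
  "clinear_on M f \<longleftrightarrow>
     (\<forall>x\<in>M. \<forall>y\<in>M. f (x + y) = f x + f y) \<and> (\<forall>c. \<forall>x\<in>M. f (c *\<^sub>C x) = c *\<^sub>C f x)"

definition cbilinear :: "('a::complex_normed_vector \<Rightarrow> 'b::complex_normed_vector \<Rightarrow>
    'c::complex_normed_vector) \<Rightarrow> bool" where
  "cbilinear f \<longleftrightarrow> (\<forall>x. clinear_on UNIV (f x)) \<and> (\<forall>y. clinear_on UNIV (\<lambda>x. f x y))"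

definition star_hom :: "('a::cstar_algebra \<Rightarrow> 'b::cstar_algebra) \<Rightarrow> bool" where
  "star_hom f \<longleftrightarrow> clinear_on UNIV f \<and> f 1 = 1 \<and>
     (\<forall>x y. f (x * y) = f x * f y) \<and> (\<forall>x. f (star x) = star (f x))"

text \<open>Unital *-representation of the unital *-subalgebra \<open>M\<close> by bounded operators.\<close>

definition star_rep :: "'a::cstar_algebra set \<Rightarrow> ('a \<Rightarrow> 'h::chilbert_space \<Rightarrow> 'h) \<Rightarrow> bool" where
  "star_rep M \<pi> \<longleftrightarrow>
     (\<forall>a\<in>M. bounded_linear (\<pi> a) \<and> clinear_on UNIV (\<pi> a)) \<and>
     (\<forall>v. clinear_on M (\<lambda>a. \<pi> a v)) \<and>
     (\<forall>a\<in>M. \<forall>b\<in>M. \<forall>v. \<pi> (a * b) v = \<pi> a (\<pi> b v)) \<and>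
     (\<forall>v. \<pi> 1 v = v) \<and>
     (\<forall>a\<in>M. \<forall>v w. cinner (\<pi> (star a) v) w = cinner v (\<pi> a w))"


section \<open>Tensor products\<close>

text \<open>Tensor products are described up to canonical isomorphism: a type of the appropriate class
  together with the map sending a pair to its elementary tensor.\<close>

definition hilbert_tensor :: "('h::chilbert_space \<Rightarrow> 'k::chilbert_space \<Rightarrow>
    'g::chilbert_space) \<Rightarrow> bool" where
  "hilbert_tensor \<theta> \<longleftrightarrow> cbilinear \<theta> \<and>
     (\<forall>v v' w w'. cinner (\<theta> v w) (\<theta> v' w') = cinner v v' * cinner w w') \<and>
     closure (cspan {\<theta> v w |v w. True}) = UNIV"

definition cstar_norm_on :: "'a::cstar_algebra set \<Rightarrow> ('a \<Rightarrow> real) \<Rightarrow> bool" where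
  "cstar_norm_on M p \<longleftrightarrow>
     (\<forall>x\<in>M. p x \<ge> 0 \<and> (p x = 0 \<longleftrightarrow> x = 0)) \<and>
     (\<forall>x\<in>M. \<forall>y\<in>M. p (x + y) \<le> p x + p y) \<and>
     (\<forall>c. \<forall>x\<in>M. p (c *\<^sub>C x) = cmod c * p x) \<and>
     (\<forall>x\<in>M. \<forall>y\<in>M. p (x * y) \<le> p x * p y) \<and>
     (\<forall>x\<in>M. p (star x * x) = (p x)\<^sup>2)"

text \<open>The completion of the algebraic tensor product for its smallest C*-norm.
  The axiom \<open>injective\<close> says that the algebraic tensor product embeds.\<close>

locale cstar_min_tensor =
  fixes \<tau> :: "'a::cstar_algebra \<Rightarrow> 'b::cstar_algebra \<Rightarrow> 't::cstar_algebra"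
  assumes bilinear: "cbilinear \<tau>"
    and mult: "\<tau> a b * \<tau> a' b' = \<tau> (a * a') (b * b')"
    and unit: "\<tau> 1 1 = 1"
    and star: "star (\<tau> a b) = \<tau> (star a) (star b)"
    and injective: "(\<Sum>i<(n::nat). \<tau> (x i) (y i)) = 0 \<Longrightarrow> inj_on y {..<n} \<Longrightarrow>
        cindependent (y ` {..<n}) \<Longrightarrow> i < n \<Longrightarrow> x i = 0"
    and dense: "closure (cspan {\<tau> a b |a b. True}) = UNIV"
    and minimal: "cstar_norm_on (cspan {\<tau> a b |a b. True}) p \<Longrightarrow>
        t \<in> cspan {\<tau> a b |a b. True} \<Longrightarrow> norm t \<le> p t"

text \<open>For \<open>t\<close> in the algebraic tensor product of \<open>M\<close> with itself, the image of \<open>t\<close> under the linear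
  map induced by the bilinear map \<open>B\<close> on \<open>M \<times> M\<close>.\<close>

definition tensor_lift :: "('a \<Rightarrow> 'a \<Rightarrow> 't::comm_monoid_add) \<Rightarrow> 'a set \<Rightarrow>
    ('a \<Rightarrow> 'a \<Rightarrow> 'v::comm_monoid_add) \<Rightarrow> 't \<Rightarrow> 'v" where
  "tensor_lift \<tau> M B t = (THE v. \<exists>(n::nat) x y. (\<forall>i<n. x i \<in> M \<and> y i \<in> M) \<and>
     t = (\<Sum>i<n. \<tau> (x i) (y i)) \<and> v = (\<Sum>i<n. B (x i) (y i)))"


section \<open>Compact quantum groups\<close>

text \<open>\<open>\<tau>l\<close> and \<open>\<tau>r\<close> present the threefold tensor product as \<open>(A \<otimes> A) \<otimes> A\<close> and as
  \<open>A \<otimes> (A \<otimes> A)\<close>; the maps \<open>F\<close>, \<open>G\<close> in \<open>coassoc\<close> are \<open>\<Delta> \<otimes> id\<close> and \<open>id \<otimes> \<Delta>\<close>.\<close>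

locale compact_quantum_group =
  fixes \<tau> :: "'a::cstar_algebra \<Rightarrow> 'a \<Rightarrow> 't::cstar_algebra"
    and \<tau>l :: "'t \<Rightarrow> 'a \<Rightarrow> 't3::cstar_algebra"
    and \<tau>r :: "'a \<Rightarrow> 't \<Rightarrow> 't3"
    and \<Delta> :: "'a \<Rightarrow> 't"
  assumes tensor2: "cstar_min_tensor \<tau>"
    and tensor3_left: "cstar_min_tensor \<tau>l"
    and tensor3_right: "cstar_min_tensor \<tau>r"
    and tensor_assoc: "\<tau>l (\<tau> a b) c = \<tau>r a (\<tau> b c)"
    and comult_hom: "star_hom \<Delta>"
    and coassoc: "\<exists>F G. star_hom F \<and> star_hom G \<and>
        (\<forall>a b. F (\<tau> a b) = \<tau>l (\<Delta> a) b) \<and> (\<forall>a b. G (\<tau> a b) = \<tau>r a (\<Delta> b)) \<and>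
        (\<forall>a. F (\<Delta> a) = G (\<Delta> a))"
    and cancel_left: "closure (cspan {\<tau> a 1 * \<Delta> b |a b. True}) = UNIV"
    and cancel_right: "closure (cspan {\<tau> 1 a * \<Delta> b |a b. True}) = UNIV"

definition unitary_corep :: "('a::cstar_algebra \<Rightarrow> 'a \<Rightarrow> 't::cstar_algebra) \<Rightarrow> ('a \<Rightarrow> 't) \<Rightarrow>
    nat \<Rightarrow> (nat \<Rightarrow> nat \<Rightarrow> 'a) \<Rightarrow> bool" where
  "unitary_corep \<tau> \<Delta> n u \<longleftrightarrow> (\<forall>i<n. \<forall>j<n.
     \<Delta> (u i j) = (\<Sum>k<n. \<tau> (u i k) (u k j)) \<and>
     (\<Sum>k<n. u i k * star (u j k)) = (if i = j then 1 else 0) \<and>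
     (\<Sum>k<n. star (u k i) * u k j) = (if i = j then 1 else 0))"

definition hopf_core :: "('a::cstar_algebra \<Rightarrow> 'a \<Rightarrow> 't::cstar_algebra) \<Rightarrow> ('a \<Rightarrow> 't) \<Rightarrow> 'a set" where
  "hopf_core \<tau> \<Delta> = cspan {u i j |n u i j. unitary_corep \<tau> \<Delta> n u \<and> i < n \<and> j < n}"

text \<open>\<open>sweedler \<tau> \<Delta> B a\<close> is \<open>B a\<^sub>(\<^sub>1\<^sub>) a\<^sub>(\<^sub>2\<^sub>)\<close> in Sweedler notation.\<close>

definition sweedler :: "('a::cstar_algebra \<Rightarrow> 'a \<Rightarrow> 't::cstar_algebra) \<Rightarrow> ('a \<Rightarrow> 't) \<Rightarrow>
    ('a \<Rightarrow> 'a \<Rightarrow> 'v::comm_monoid_add) \<Rightarrow> 'a \<Rightarrow> 'v" where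
  "sweedler \<tau> \<Delta> B a = tensor_lift \<tau> (hopf_core \<tau> \<Delta>) B (\<Delta> a)"

text \<open>The counit and the antipode of the dense Hopf *-algebra are uniquely determined by the
  following properties; multiplicativity and compatibility with the involution are consequences.\<close>

definition is_counit :: "('a::cstar_algebra \<Rightarrow> 'a \<Rightarrow> 't::cstar_algebra) \<Rightarrow> ('a \<Rightarrow> 't) \<Rightarrow>
    ('a \<Rightarrow> complex) \<Rightarrow> bool" where
  "is_counit \<tau> \<Delta> \<epsilon> \<longleftrightarrow> clinear_on (hopf_core \<tau> \<Delta>) \<epsilon> \<and>
     (\<forall>a\<in>hopf_core \<tau> \<Delta>. sweedler \<tau> \<Delta> (\<lambda>x y. \<epsilon> x *\<^sub>C y) a = a \<and>
                        sweedler \<tau> \<Delta> (\<lambda>x y. \<epsilon> y *\<^sub>C x) a = a)"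

definition is_antipode :: "('a::cstar_algebra \<Rightarrow> 'a \<Rightarrow> 't::cstar_algebra) \<Rightarrow> ('a \<Rightarrow> 't) \<Rightarrow>
    ('a \<Rightarrow> complex) \<Rightarrow> ('a \<Rightarrow> 'a) \<Rightarrow> bool" where
  "is_antipode \<tau> \<Delta> \<epsilon> S \<longleftrightarrow> clinear_on (hopf_core \<tau> \<Delta>) S \<and> S ` hopf_core \<tau> \<Delta> \<subseteq> hopf_core \<tau> \<Delta> \<and>
     (\<forall>a\<in>hopf_core \<tau> \<Delta>. sweedler \<tau> \<Delta> (\<lambda>x y. S x * y) a = \<epsilon> a *\<^sub>C 1 \<and>
                        sweedler \<tau> \<Delta> (\<lambda>x y. x * S y) a = \<epsilon> a *\<^sub>C 1)"

definition is_state :: "('a::cstar_algebra \<Rightarrow> complex) \<Rightarrow> bool" where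
  "is_state h \<longleftrightarrow> clinear_on UNIV h \<and> h 1 = 1 \<and> (\<forall>a. h (star a * a) \<in> nonneg_Reals)"

text \<open>\<open>E\<^sub>1\<close> and \<open>E\<^sub>2\<close> are the slice maps \<open>id \<otimes> h\<close> and \<open>h \<otimes> id\<close>, determined by
  continuity and their values on elementary tensors.\<close>

definition is_haar_state :: "('a::cstar_algebra \<Rightarrow> 'a \<Rightarrow> 't::cstar_algebra) \<Rightarrow> ('a \<Rightarrow> 't) \<Rightarrow>
    ('a \<Rightarrow> complex) \<Rightarrow> bool" where
  "is_haar_state \<tau> \<Delta> h \<longleftrightarrow> is_state h \<and>
     (\<exists>E\<^sub>1. bounded_linear E\<^sub>1 \<and> clinear_on UNIV E\<^sub>1 \<and> (\<forall>a b. E\<^sub>1 (\<tau> a b) = h b *\<^sub>C a) \<and>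
           (\<forall>a. E\<^sub>1 (\<Delta> a) = h a *\<^sub>C 1)) \<and>
     (\<exists>E\<^sub>2. bounded_linear E\<^sub>2 \<and> clinear_on UNIV E\<^sub>2 \<and> (\<forall>a b. E\<^sub>2 (\<tau> a b) = h a *\<^sub>C b) \<and>
           (\<forall>a. E\<^sub>2 (\<Delta> a) = h a *\<^sub>C 1))"

definition faithful_state :: "('a::cstar_algebra \<Rightarrow> complex) \<Rightarrow> bool" where
  "faithful_state h \<longleftrightarrow> (\<forall>a. h (star a * a) = 0 \<longrightarrow> a = 0)"

definition gns_triple :: "('a::cstar_algebra \<Rightarrow> complex) \<Rightarrow> ('a \<Rightarrow> 'h::chilbert_space \<Rightarrow> 'h) \<Rightarrow>
    'h \<Rightarrow> bool" where
  "gns_triple h \<rho> \<xi> \<longleftrightarrow> star_rep UNIV \<rho> \<and> (\<forall>a. h a = cinner \<xi> (\<rho> a \<xi>)) \<and>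
     closure (range (\<lambda>a. \<rho> a \<xi>)) = UNIV"

text \<open>The analytically continued modular automorphism group of \<open>h\<close> on the *-algebra \<open>M\<close>: an entire
  one-parameter group of algebra automorphisms, acting by *-automorphisms at real times, that leaves
  \<open>h\<close> invariant and satisfies the KMS condition. These properties determine it uniquely.\<close>

definition is_modular_group :: "'a::cstar_algebra set \<Rightarrow> ('a \<Rightarrow> complex) \<Rightarrow>
    (complex \<Rightarrow> 'a \<Rightarrow> 'a) \<Rightarrow> bool" where
  "is_modular_group M h \<sigma> \<longleftrightarrow>
     (\<forall>z. clinear_on M (\<sigma> z) \<and> \<sigma> z ` M \<subseteq> M \<and> \<sigma> z 1 = 1 \<and>
          (\<forall>a\<in>M. \<forall>b\<in>M. \<sigma> z (a * b) = \<sigma> z a * \<sigma> z b)) \<and>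
     (\<forall>a\<in>M. \<sigma> 0 a = a) \<and>
     (\<forall>z w. \<forall>a\<in>M. \<sigma> (z + w) a = \<sigma> z (\<sigma> w a)) \<and>
     (\<forall>z. \<forall>a\<in>M. star (\<sigma> z a) = \<sigma> (cnj z) (star a)) \<and>
     (\<forall>a\<in>M. \<forall>b\<in>M. (\<lambda>z. h (b * \<sigma> z a)) holomorphic_on UNIV) \<and>
     (\<forall>z. \<forall>a\<in>M. h (\<sigma> z a) = h a) \<and>
     (\<forall>a\<in>M. \<forall>b\<in>M. h (a * b) = h (b * \<sigma> (- \<i>) a))"


section \<open>Generating functionals and Schuermann triples\<close>

definition generating_functional :: "'a::cstar_algebra set \<Rightarrow> ('a \<Rightarrow> complex) \<Rightarrow>
    ('a \<Rightarrow> complex) \<Rightarrow> bool" where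
  "generating_functional M \<epsilon> \<phi> \<longleftrightarrow> clinear_on M \<phi> \<and> (\<forall>a\<in>M. \<phi> (star a) = cnj (\<phi> a)) \<and>
     \<phi> 1 = 0 \<and> (\<forall>a\<in>M. \<epsilon> a = 0 \<longrightarrow> \<phi> (star a * a) \<in> nonneg_Reals)"

definition gns_symmetric :: "'a set \<Rightarrow> ('a \<Rightarrow> 'a) \<Rightarrow> ('a \<Rightarrow> complex) \<Rightarrow> bool" where
  "gns_symmetric M S \<phi> \<longleftrightarrow> (\<forall>a\<in>M. \<phi> (S a) = \<phi> a)"

definition schuermann_triple :: "'a::cstar_algebra set \<Rightarrow> ('a \<Rightarrow> complex) \<Rightarrow>
    ('a \<Rightarrow> 'k::chilbert_space \<Rightarrow> 'k) \<Rightarrow> ('a \<Rightarrow> 'k) \<Rightarrow> ('a \<Rightarrow> complex) \<Rightarrow> bool" where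
  "schuermann_triple M \<epsilon> \<pi> \<eta> \<phi> \<longleftrightarrow> star_rep M \<pi> \<and> clinear_on M \<eta> \<and> closure (\<eta> ` M) = UNIV \<and>
     (\<forall>a\<in>M. \<forall>b\<in>M. \<eta> (a * b) = \<pi> a (\<eta> b) + \<epsilon> b *\<^sub>C \<eta> a) \<and>
     (\<forall>a\<in>M. \<forall>b\<in>M. \<epsilon> a = 0 \<longrightarrow> \<epsilon> b = 0 \<longrightarrow> \<phi> (a * b) = cinner (\<eta> (star a)) (\<eta> b))"

definition conv_operator :: "('a::cstar_algebra \<Rightarrow> 'a \<Rightarrow> 't::cstar_algebra) \<Rightarrow> ('a \<Rightarrow> 't) \<Rightarrow>
    ('a \<Rightarrow> complex) \<Rightarrow> 'a \<Rightarrow> 'a" where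
  "conv_operator \<tau> \<Delta> \<phi> = sweedler \<tau> \<Delta> (\<lambda>x y. \<phi> y *\<^sub>C x)"


section \<open>Closures of operators and quadratic forms\<close>

definition op_graph :: "'h set \<Rightarrow> ('h \<Rightarrow> 'g) \<Rightarrow> ('h \<times> 'g) set" where
  "op_graph D T = {(v, T v) |v. v \<in> D}"

definition closable :: "'h::complex_normed_vector set \<Rightarrow> ('h \<Rightarrow> 'g::complex_normed_vector) \<Rightarrow>
    bool" where
  "closable D T \<longleftrightarrow> csubspace D \<and> clinear_on D T \<and>
     (\<forall>v w w'. (v, w) \<in> closure (op_graph D T) \<and> (v, w') \<in> closure (op_graph D T) \<longrightarrow> w = w')"

definition op_closure :: "'h::topological_space set \<Rightarrow> ('h \<Rightarrow> 'g::topological_space) \<Rightarrow> 'h \<Rightarrow> 'g" where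
  "op_closure D T v = (THE w. (v, w) \<in> closure (op_graph D T))"

text \<open>The closure of a closable form \<open>q\<close>: its value at \<open>v\<close> is the limit of \<open>q\<close> along any sequence
  in \<open>D\<close> that converges to \<open>v\<close> and is \<open>q\<close>-Cauchy.\<close>

definition form_closure :: "'h::complex_normed_vector set \<Rightarrow> ('h \<Rightarrow> complex) \<Rightarrow> 'h \<Rightarrow> complex" where
  "form_closure D q v = (THE e. \<exists>X. (\<forall>n. X n \<in> D) \<and> X \<longlonglongrightarrow> v \<and>
     (\<forall>r>0. \<exists>N. \<forall>m\<ge>N. \<forall>n\<ge>N. cmod (q (X m - X n)) < r) \<and> (\<lambda>n. q (X n)) \<longlonglongrightarrow> e)"


section \<open>The operator \<open>H\<^sub>\<phi>\<close>, the Dirichlet form and the derivation\<close>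

definition sym_embedding :: "(complex \<Rightarrow> 'a \<Rightarrow> 'a) \<Rightarrow> ('a \<Rightarrow> 'h \<Rightarrow> 'h) \<Rightarrow> 'h \<Rightarrow> 'a \<Rightarrow> 'h" where
  "sym_embedding \<sigma> \<rho> \<xi> a = \<rho> (\<sigma> (- \<i> / 4) a) \<xi>"

definition H_core :: "('a::cstar_algebra \<Rightarrow> 'a \<Rightarrow> 't::cstar_algebra) \<Rightarrow> ('a \<Rightarrow> 't) \<Rightarrow>
    (complex \<Rightarrow> 'a \<Rightarrow> 'a) \<Rightarrow> ('a \<Rightarrow> 'h::chilbert_space \<Rightarrow> 'h) \<Rightarrow> 'h \<Rightarrow> ('a \<Rightarrow> complex) \<Rightarrow> 'h \<Rightarrow> 'h" where
  "H_core \<tau> \<Delta> \<sigma> \<rho> \<xi> \<phi> v =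
     - sym_embedding \<sigma> \<rho> \<xi> (conv_operator \<tau> \<Delta> \<phi> (inv_into (hopf_core \<tau> \<Delta>) (sym_embedding \<sigma> \<rho> \<xi>) v))"

definition H_op :: "('a::cstar_algebra \<Rightarrow> 'a \<Rightarrow> 't::cstar_algebra) \<Rightarrow> ('a \<Rightarrow> 't) \<Rightarrow>
    (complex \<Rightarrow> 'a \<Rightarrow> 'a) \<Rightarrow> ('a \<Rightarrow> 'h::chilbert_space \<Rightarrow> 'h) \<Rightarrow> 'h \<Rightarrow> ('a \<Rightarrow> complex) \<Rightarrow> 'h \<Rightarrow> 'h" where
  "H_op \<tau> \<Delta> \<sigma> \<rho> \<xi> \<phi> = op_closure (sym_embedding \<sigma> \<rho> \<xi> ` hopf_core \<tau> \<Delta>) (H_core \<tau> \<Delta> \<sigma> \<rho> \<xi> \<phi>)"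

definition dirichlet_form :: "('a::cstar_algebra \<Rightarrow> 'a \<Rightarrow> 't::cstar_algebra) \<Rightarrow> ('a \<Rightarrow> 't) \<Rightarrow>
    (complex \<Rightarrow> 'a \<Rightarrow> 'a) \<Rightarrow> ('a \<Rightarrow> 'h::chilbert_space \<Rightarrow> 'h) \<Rightarrow> 'h \<Rightarrow> ('a \<Rightarrow> complex) \<Rightarrow>
    'h \<Rightarrow> complex" where
  "dirichlet_form \<tau> \<Delta> \<sigma> \<rho> \<xi> \<phi> =
     form_closure (sym_embedding \<sigma> \<rho> \<xi> ` hopf_core \<tau> \<Delta>) (\<lambda>v. cinner v (H_core \<tau> \<Delta> \<sigma> \<rho> \<xi> \<phi> v))"

definition gns_map :: "('a \<Rightarrow> 'h \<Rightarrow> 'h) \<Rightarrow> 'h \<Rightarrow> 'a \<Rightarrow> 'h" where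
  "gns_map \<rho> \<xi> a = \<rho> a \<xi>"

definition derivation :: "('a::cstar_algebra \<Rightarrow> 'a \<Rightarrow> 't::cstar_algebra) \<Rightarrow> ('a \<Rightarrow> 't) \<Rightarrow>
    ('h \<Rightarrow> 'k \<Rightarrow> 'g::chilbert_space) \<Rightarrow> ('a \<Rightarrow> 'h \<Rightarrow> 'h) \<Rightarrow> 'h \<Rightarrow> ('a \<Rightarrow> 'k) \<Rightarrow> 'a \<Rightarrow> 'g" where
  "derivation \<tau> \<Delta> \<theta> \<rho> \<xi> \<eta> = sweedler \<tau> \<Delta> (\<lambda>x y. \<theta> (gns_map \<rho> \<xi> x) (\<eta> y))"

definition d_dom :: "('a::cstar_algebra \<Rightarrow> 'a \<Rightarrow> 't::cstar_algebra) \<Rightarrow> ('a \<Rightarrow> 't) \<Rightarrow>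
    ('a \<Rightarrow> 'h \<Rightarrow> 'h) \<Rightarrow> 'h \<Rightarrow> 'h set" where
  "d_dom \<tau> \<Delta> \<rho> \<xi> = gns_map \<rho> \<xi> ` hopf_core \<tau> \<Delta>"

definition d_op :: "('a::cstar_algebra \<Rightarrow> 'a \<Rightarrow> 't::cstar_algebra) \<Rightarrow> ('a \<Rightarrow> 't) \<Rightarrow>
    ('h \<Rightarrow> 'k \<Rightarrow> 'g::chilbert_space) \<Rightarrow> ('a \<Rightarrow> 'h \<Rightarrow> 'h) \<Rightarrow> 'h \<Rightarrow> ('a \<Rightarrow> 'k) \<Rightarrow> 'h \<Rightarrow> 'g" where
  "d_op \<tau> \<Delta> \<theta> \<rho> \<xi> \<eta> v = derivation \<tau> \<Delta> \<theta> \<rho> \<xi> \<eta> (inv_into (hopf_core \<tau> \<Delta>) (gns_map \<rho> \<xi>) v)"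

end

theory Submission
  imports Defs "HOL-Computational_Algebra.Fundamental_Theorem_Algebra"
begin

text \<open>
  Write \<open>L\<close> for the convolution operator \<open>a \<mapsto> a\<^sub>(\<^sub>1\<^sub>) \<phi>(a\<^sub>(\<^sub>2\<^sub>))\<close>. Everything follows from the identity
  \<open>\<langle>\<partial>a, \<partial>b\<rangle> = - 2 h(a\<^sup>* L b)\<close> on the Hopf algebra (\<open>derivation_inner\<close>). Because \<open>\<eta>\<close> kills the unit,
  \<open>\<langle>\<eta>(x), \<eta>(y)\<rangle>\<close> is \<open>\<phi>(x\<^sup>* y)\<close> minus two terms with the counit. Summed against
  \<open>h(a\<^sub>(\<^sub>1\<^sub>)\<^sup>* b\<^sub>(\<^sub>1\<^sub>))\<close>, the first gives \<open>h(a\<^sup>* b) \<phi>(1) = 0\<close> by invariance of the Haar state, and the other two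
  give \<open>- h(a\<^sup>* L b)\<close> and \<open>- h((L a)\<^sup>* b)\<close>. These agree: strong invariance
  \<open>h(a\<^sub>(\<^sub>1\<^sub>) b) a\<^sub>(\<^sub>2\<^sub>) = h(a b\<^sub>(\<^sub>1\<^sub>)) S(b\<^sub>(\<^sub>2\<^sub>))\<close> turns GNS-symmetry \<open>\<phi> \<circ> S = \<phi>\<close> into symmetry of \<open>L\<close> for \<open>h\<close>.

  Closability is then formal. An inner product of two values of \<open>d\<close> can be written as an inner product of the
  first argument with a vector depending on the second one, so limits of \<open>d\<close> along null sequences are
  orthogonal to the range of \<open>d\<close> and hence vanish (\<open>closableI\<close>). The same argument makes the core of \<open>H\<^sub>\<phi>\<close>
  closable, and the closed form agrees with the original one on its domain because it equals
  \<open>\<parallel>d v\<parallel>\<^sup>2 / 2\<close> there (\<open>form_closure_eq\<close>).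

  The operator \<open>H\<^sub>\<phi>\<close> is defined through the symmetric embedding, so on \<open>a \<xi>\<close> it involves
  \<open>\<sigma>\<^bsub>-i/4\<^esub> L \<sigma>\<^bsub>i/4\<^esub> a\<close> instead of \<open>L a\<close>. It remains to show that \<open>L\<close> commutes with \<open>\<sigma>\<^bsub>-i/4\<^esub>\<close>.
  Symmetry of \<open>L\<close> and the KMS condition give commutation with \<open>\<sigma>\<^bsub>-i\<^esub>\<close> at once. To pass to the fourth root,
  the Hopf algebra is shown to be spanned by eigenvectors of \<open>\<sigma>\<^bsub>-i\<^esub>\<close> (\<open>M_eigenspan\<close>): the coefficient space
  of every corepresentation is finite-dimensional and invariant under \<open>\<sigma>\<^bsub>-i\<^esub>\<close>
  (\<open>kms_preserves_coeff_space\<close>), and \<open>\<sigma>\<^bsub>-i\<^esub>\<close> is positive for the inner product \<open>h(a\<^sup>* b)\<close>. On an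
  eigenvector, positivity forces \<open>\<sigma>\<^bsub>-i/4\<^esub>\<close> to act as the positive fourth root of the eigenvalue, so whatever
  commutes with \<open>\<sigma>\<^bsub>-i\<^esub>\<close> commutes with \<open>\<sigma>\<^bsub>-i/4\<^esub>\<close>.
\<close>

section \<open>Complex linear algebra\<close>

interpretation cvec: vector_space "scaleC :: complex \<Rightarrow> 'a::complex_normed_vector \<Rightarrow> 'a"
proof
  show "1 *\<^sub>C x = x" for x :: 'a
    using scaleC_of_real[of 1 x] by simp
qed (simp_all add: scaleC_add_right scaleC_add_left scaleC_scaleC)

interpretation cvec_pair: vector_space_pair
    "scaleC :: complex \<Rightarrow> 'a::complex_normed_vector \<Rightarrow> 'a"
    "scaleC :: complex \<Rightarrow> 'b::complex_normed_vector \<Rightarrow> 'b"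
  by unfold_locales

lemma scaleC_complex_eq [simp]: "c *\<^sub>C (x::complex) = c * x"
  by (simp add: scaleC_complex_def)

lemma scaleR_eq_scaleC: "r *\<^sub>R x = complex_of_real r *\<^sub>C x"
  by (simp add: scaleC_of_real)

lemma clinear_onI:
  assumes "\<And>x y. x \<in> N \<Longrightarrow> y \<in> N \<Longrightarrow> f (x + y) = f x + f y"
    and "\<And>c x. x \<in> N \<Longrightarrow> f (c *\<^sub>C x) = c *\<^sub>C f x"
  shows "clinear_on N f"
  using assms by (simp add: clinear_on_def)

lemma clinear_on_add: "clinear_on N f \<Longrightarrow> x \<in> N \<Longrightarrow> y \<in> N \<Longrightarrow> f (x + y) = f x + f y"
  by (simp add: clinear_on_def)

lemma clinear_on_scale: "clinear_on N f \<Longrightarrow> x \<in> N \<Longrightarrow> f (c *\<^sub>C x) = c *\<^sub>C f x"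
  by (simp add: clinear_on_def)

lemma clinear_on_subset: "clinear_on N f \<Longrightarrow> N' \<subseteq> N \<Longrightarrow> clinear_on N' f"
  unfolding clinear_on_def by blast

lemma clinear_on_zero: "clinear_on N f \<Longrightarrow> csubspace N \<Longrightarrow> f 0 = 0"
  using clinear_on_scale[of N f 0 0] by (simp add: cvec.subspace_0)

lemma clinear_on_neg: "clinear_on N f \<Longrightarrow> x \<in> N \<Longrightarrow> f (- x) = - f x"
  using clinear_on_scale[of N f x "-1"] by simp

lemma clinear_on_diff:
  "clinear_on N f \<Longrightarrow> csubspace N \<Longrightarrow> x \<in> N \<Longrightarrow> y \<in> N \<Longrightarrow> f (x - y) = f x - f y"
  using clinear_on_add[of N f x "- y"] clinear_on_neg[of N f y] cvec.subspace_neg[of N y] by simp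

lemma clinear_on_sum:
  assumes "clinear_on N f" "csubspace N" "\<And>i. i \<in> I \<Longrightarrow> x i \<in> N"
  shows "f (\<Sum>i\<in>I. x i) = (\<Sum>i\<in>I. f (x i))"
  using assms(3)
proof (induction I rule: infinite_finite_induct)
  case (insert i I)
  then have "(\<Sum>i\<in>I. x i) \<in> N"
    by (intro cvec.subspace_sum assms(2)) simp
  with insert show ?case
    using clinear_on_add[OF assms(1), of "x i" "\<Sum>i\<in>I. x i"] by simp
qed (use clinear_on_zero assms in auto)

lemma clinear_on_lincomb:
  assumes "clinear_on N f" "csubspace N" "\<And>i. i \<in> I \<Longrightarrow> x i \<in> N"
  shows "f (\<Sum>i\<in>I. c i *\<^sub>C x i) = (\<Sum>i\<in>I. c i *\<^sub>C f (x i))"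
proof -
  have "f (\<Sum>i\<in>I. c i *\<^sub>C x i) = (\<Sum>i\<in>I. f (c i *\<^sub>C x i))"
    by (rule clinear_on_sum) (use assms in \<open>auto intro: cvec.subspace_scale\<close>)
  also have "\<dots> = (\<Sum>i\<in>I. c i *\<^sub>C f (x i))"
    using assms by (intro sum.cong) (auto simp: clinear_on_scale)
  finally show ?thesis .
qed

lemma clinear_on_eq_cspan:
  assumes "clinear_on (cspan B) f" "clinear_on (cspan B) g"
    and "\<And>b. b \<in> B \<Longrightarrow> f b = g b" and "x \<in> cspan B"
  shows "f x = g x"
proof -
  have "f x = g x \<and> x \<in> cspan B"
    using assms(4)
  proof (induction rule: cvec.span_induct_alt)
    case base
    then show ?case
      using clinear_on_zero[OF assms(1) cvec.subspace_span]
        clinear_on_zero[OF assms(2) cvec.subspace_span] by (simp add: cvec.span_zero)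
  next
    case (step c x y)
    then have "x \<in> cspan B" "c *\<^sub>C x \<in> cspan B"
      by (auto intro: cvec.span_base cvec.span_scale)
    with step assms(3) show ?case
      by (simp add: clinear_on_add[OF assms(1)] clinear_on_add[OF assms(2)] cvec.span_add
          clinear_on_scale[OF assms(1)] clinear_on_scale[OF assms(2)])
  qed
  then show ?thesis ..
qed

lemma clinear_on_image_cspan:
  assumes "clinear_on (cspan B) f" "\<And>b. b \<in> B \<Longrightarrow> f b \<in> W" "csubspace W" "x \<in> cspan B"
  shows "f x \<in> W"
proof -
  have "f x \<in> W \<and> x \<in> cspan B"
    using assms(4)
  proof (induction rule: cvec.span_induct_alt)
    case base
    then show ?case
      using clinear_on_zero[OF assms(1) cvec.subspace_span]
      by (simp add: cvec.span_zero cvec.subspace_0 assms)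
  next
    case (step c x y)
    then have "x \<in> cspan B" "c *\<^sub>C x \<in> cspan B"
      by (auto intro: cvec.span_base cvec.span_scale)
    with step assms(2,3) show ?case
      by (simp add: clinear_on_add[OF assms(1)] cvec.span_add
          clinear_on_scale[OF assms(1)] cvec.subspace_add cvec.subspace_scale)
  qed
  then show ?thesis ..
qed

text \<open>Extend a basis of the span by the given vector. With these functionals, membership in a coefficient space
  reduces to scalar identities.\<close>

lemma separating_functional:
  fixes x :: "'a::complex_normed_vector"
  assumes "x \<notin> cspan B"
  obtains g :: "'a \<Rightarrow> complex"
  where "clinear_on UNIV g" "\<And>b. b \<in> B \<Longrightarrow> g b = 0" "g x = 1"
proof -
  obtain C where C: "C \<subseteq> B" "cindependent C" "B \<subseteq> cspan C"
    using cvec.maximal_independent_subset by blast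
  have x: "x \<notin> cspan C"
    using assms C(1) cvec.span_mono by blast
  then have "cindependent (insert x C)"
    using C(2) by (intro cvec.independent_insertI)
  then obtain g :: "'a \<Rightarrow> complex" where g: "Vector_Spaces.linear scaleC scaleC g"
      "\<forall>y\<in>insert x C. g y = (if y = x then 1 else 0)"
    using cvec_pair.linear_independent_extend[of "insert x C" "\<lambda>y. if y = x then 1 else (0::complex)"]
    by blast
  interpret g: Vector_Spaces.linear "scaleC :: complex \<Rightarrow> 'a \<Rightarrow> 'a" "scaleC :: complex \<Rightarrow> complex \<Rightarrow> complex" g
    by fact
  have lin: "clinear_on UNIV g"
    by (rule clinear_onI) (simp_all add: g.add g.scale)
  have C0: "g y = 0" if "y \<in> C" for y
    using g(2) that x cvec.span_base by fastforce
  have "g b = 0" if "b \<in> B" for b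
    using that C(3) C0 clinear_on_eq_cspan[of C g "\<lambda>_. 0" b] lin
    by (auto simp: clinear_on_def)
  with lin g(2) show ?thesis by (intro that[of g]) auto
qed

definition cbilinear_on ::
    "'a::complex_normed_vector set \<Rightarrow> ('a \<Rightarrow> 'a \<Rightarrow> 'v::complex_normed_vector) \<Rightarrow> bool" where
  "cbilinear_on N B \<longleftrightarrow> (\<forall>x\<in>N. clinear_on N (B x)) \<and> (\<forall>y\<in>N. clinear_on N (\<lambda>x. B x y))"

text \<open>This makes maps on the algebraic tensor product well-defined. Expanding the second legs in a linearly
  independent subset turns every bilinear sum over the family into one over that subset, where the
  axiom \<open>injective\<close> makes the new first legs vanish.\<close>

lemma (in cstar_min_tensor) tensor_zero_imp_bilinear_zero:
  fixes x :: "'i \<Rightarrow> 'a" and y :: "'i \<Rightarrow> 'b" and B :: "'a \<Rightarrow> 'b \<Rightarrow> 'v::complex_normed_vector"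
  assumes I: "finite I" "(\<Sum>i\<in>I. \<tau> (x i) (y i)) = 0"
    and xN: "\<And>i. i \<in> I \<Longrightarrow> x i \<in> N" and yN: "\<And>i. i \<in> I \<Longrightarrow> y i \<in> N'"
    and sub: "csubspace N" "csubspace N'"
    and B1: "\<And>b. b \<in> N' \<Longrightarrow> clinear_on N (\<lambda>a. B a b)" and B2: "\<And>a. a \<in> N \<Longrightarrow> clinear_on N' (B a)"
  shows "(\<Sum>i\<in>I. B (x i) (y i)) = 0"
proof -
  obtain Y where Y: "Y \<subseteq> y ` I" "cindependent Y" "y ` I \<subseteq> cspan Y"
    using cvec.maximal_independent_subset by blast
  have fin: "finite Y"
    using Y(1) I(1) finite_subset by blast
  have "\<forall>i\<in>I. \<exists>c. y i = (\<Sum>e\<in>Y. c e *\<^sub>C e)"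
    using Y(3) cvec.span_finite[OF fin] by (force simp: image_subset_iff)
  then obtain c where c: "\<And>i. i \<in> I \<Longrightarrow> y i = (\<Sum>e\<in>Y. c i e *\<^sub>C e)"
    by metis
  have YN: "e \<in> N'" if "e \<in> Y" for e
    using that Y(1) yN by auto
  define X where "X = (\<lambda>e. \<Sum>i\<in>I. c i e *\<^sub>C x i)"
  have regroup: "(\<Sum>i\<in>I. F (x i) (y i)) = (\<Sum>e\<in>Y. F (X e) e)"
    if F1: "\<And>b. b \<in> N' \<Longrightarrow> clinear_on N (\<lambda>a. F a b)" and F2: "\<And>a. a \<in> N \<Longrightarrow> clinear_on N' (F a)"
    for F :: "'a \<Rightarrow> 'b \<Rightarrow> 'w::complex_normed_vector"
  proof -
    have "(\<Sum>i\<in>I. F (x i) (y i)) = (\<Sum>i\<in>I. \<Sum>e\<in>Y. c i e *\<^sub>C F (x i) e)"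
    proof (rule sum.cong)
      fix i assume i: "i \<in> I"
      show "F (x i) (y i) = (\<Sum>e\<in>Y. c i e *\<^sub>C F (x i) e)"
        using clinear_on_lincomb[OF F2[OF xN[OF i]] sub(2), of Y "\<lambda>e. e" "c i"] YN c[OF i] by simp
    qed simp
    also have "\<dots> = (\<Sum>e\<in>Y. \<Sum>i\<in>I. c i e *\<^sub>C F (x i) e)"
      by (rule sum.swap)
    also have "\<dots> = (\<Sum>e\<in>Y. F (X e) e)"
      unfolding X_def
      by (intro sum.cong refl clinear_on_lincomb[OF F1 sub(1), symmetric]) (use YN xN in auto)
    finally show ?thesis .
  qed
  have \<tau>0: "(\<Sum>e\<in>Y. \<tau> (X e) e) = 0"
    using regroup[of \<tau>] I(2) bilinear by (auto simp: cbilinear_def clinear_on_def)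
  obtain e where e: "bij_betw e {0..<card Y} Y"
    using ex_bij_betw_nat_finite[OF fin] by blast
  have "X k = 0" if k: "k \<in> Y" for k
  proof -
    obtain i where i: "i < card Y" "k = e i"
      using e k unfolding bij_betw_def atLeast0LessThan by blast
    have "(\<Sum>i<card Y. \<tau> (X (e i)) (e i)) = 0"
      using sum.reindex_bij_betw[OF e, of "\<lambda>k. \<tau> (X k) k"] \<tau>0 by (simp add: atLeast0LessThan)
    then show ?thesis
      using injective[where n = "card Y" and x = "\<lambda>i. X (e i)" and y = e and i = i] e Y(2) i
      by (simp add: bij_betw_def atLeast0LessThan)
  qed
  moreover have "B 0 k = 0" if "k \<in> Y" for k
    using clinear_on_zero[OF B1 sub(1)] that YN by blast
  ultimately show ?thesis
    using regroup[of B] B1 B2 by simp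
qed

section \<open>Spans of eigenvectors\<close>

definition eigenspan :: "'a::complex_normed_vector set \<Rightarrow> ('a \<Rightarrow> 'a) \<Rightarrow> 'a set" where
  "eigenspan N T = cspan {e\<in>N. \<exists>\<mu>. T e = \<mu> *\<^sub>C e}"

text \<open>A locally finite operator without nontrivial Jordan blocks has enough eigenvectors. The hypothesis
  \<open>semisimple\<close> excludes Jordan blocks: it says that the kernels of \<open>(T - \<mu>)\<^sup>2\<close> and \<open>T - \<mu>\<close> agree.\<close>

context
  fixes N :: "'a::complex_normed_vector set" and T :: "'a \<Rightarrow> 'a"
  assumes sub: "csubspace N" and lin: "clinear_on N T" and inv: "\<And>x. x \<in> N \<Longrightarrow> T x \<in> N"
    and semisimple: "\<And>\<mu> x. x \<in> N \<Longrightarrow> T (T x - \<mu> *\<^sub>C x) = \<mu> *\<^sub>C (T x - \<mu> *\<^sub>C x) \<Longrightarrow> T x = \<mu> *\<^sub>C x"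
begin

lemma eigenspan_subset: "eigenspan N T \<subseteq> N"
  unfolding eigenspan_def by (rule cvec.span_minimal) (auto simp: sub)

text \<open>On an eigenvector whose eigenvalue differs from \<open>\<mu>\<close> the operator \<open>T - \<mu>\<close> is a nonzero scalar and can
  be inverted; only the eigenvectors for \<open>\<mu>\<close> itself are left over.\<close>

lemma eigenspan_resolve:
  assumes "y \<in> eigenspan N T"
  shows "\<exists>e y0. e \<in> eigenspan N T \<and> y0 \<in> N \<and> y = (T e - \<mu> *\<^sub>C e) + y0 \<and> T y0 = \<mu> *\<^sub>C y0"
  using assms unfolding eigenspan_def
proof (induction rule: cvec.span_induct_alt)
  case base
  show ?case
    using clinear_on_zero[OF lin sub]
    by (intro exI[of _ 0]) (simp add: cvec.span_zero cvec.subspace_0[OF sub])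
next
  case (step c x y)
  let ?E = "cspan {e\<in>N. \<exists>\<mu>. T e = \<mu> *\<^sub>C e}"
  from step obtain e y0 where e: "e \<in> ?E" "y0 \<in> N" "y = (T e - \<mu> *\<^sub>C e) + y0" "T y0 = \<mu> *\<^sub>C y0"
    by blast
  from step obtain \<nu> where x: "x \<in> N" "T x = \<nu> *\<^sub>C x"
    by blast
  have xE: "x \<in> ?E"
    using step by (intro cvec.span_base)
  have eN: "e \<in> N"
    using e(1) eigenspan_subset unfolding eigenspan_def by blast
  show ?case
  proof (cases "\<nu> = \<mu>")
    case True
    have "T (c *\<^sub>C x + y0) = \<mu> *\<^sub>C (c *\<^sub>C x + y0)"
      using x e True cvec.subspace_scale[OF sub]
      by (simp add: clinear_on_add[OF lin] clinear_on_scale[OF lin] cvec.scale_right_distrib mult.commute)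
    then show ?thesis
      using e x cvec.subspace_scale[OF sub] cvec.subspace_add[OF sub]
      by (intro exI[of _ e] exI[of _ "c *\<^sub>C x + y0"]) simp
  next
    case False
    define k where "k = c / (\<nu> - \<mu>)"
    have k: "k * \<nu> - \<mu> * k = c"
    proof -
      have "k * (\<nu> - \<mu>) = c"
        using False by (simp add: k_def)
      then show ?thesis
        by (simp add: algebra_simps)
    qed
    have "T (k *\<^sub>C x + e) = (k * \<nu>) *\<^sub>C x + T e"
      using x eN cvec.subspace_scale[OF sub]
      by (simp add: clinear_on_add[OF lin] clinear_on_scale[OF lin])
    moreover have "(k * \<nu>) *\<^sub>C x - \<mu> *\<^sub>C k *\<^sub>C x = c *\<^sub>C x"
      using k by (simp add: cvec.scale_left_diff_distrib[symmetric])
    ultimately have "c *\<^sub>C x + y = (T (k *\<^sub>C x + e) - \<mu> *\<^sub>C (k *\<^sub>C x + e)) + y0"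
      using e(3) by (simp add: cvec.scale_right_distrib algebra_simps)
    then show ?thesis
      using e xE by (intro exI[of _ "k *\<^sub>C x + e"] exI[of _ y0])
        (auto intro: cvec.span_add cvec.span_scale)
  qed
qed

text \<open>After subtracting a suitable element of the span, \<open>T - \<mu>\<close> maps the vector into its own kernel, so
  semisimplicity makes the difference an eigenvector.\<close>

lemma eigenspan_shift:
  assumes x: "x \<in> N" and "T x - \<mu> *\<^sub>C x \<in> eigenspan N T"
  shows "x \<in> eigenspan N T"
proof -
  obtain e y0 where e: "e \<in> eigenspan N T" "y0 \<in> N" "T x - \<mu> *\<^sub>C x = (T e - \<mu> *\<^sub>C e) + y0"
      "T y0 = \<mu> *\<^sub>C y0"
    using eigenspan_resolve[OF assms(2)] by blast
  have eN: "e \<in> N"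
    using e(1) eigenspan_subset by blast
  have xe: "x - e \<in> N"
    using x eN sub by (simp add: cvec.subspace_diff)
  have "T (x - e) - \<mu> *\<^sub>C (x - e) = y0"
    using e(3) by (simp add: clinear_on_diff[OF lin sub x eN] cvec.scale_right_diff_distrib algebra_simps)
  then have "T (x - e) = \<mu> *\<^sub>C (x - e)"
    using semisimple[OF xe, of \<mu>] e(4) by simp
  then have "x - e \<in> eigenspan N T"
    unfolding eigenspan_def using xe by (intro cvec.span_base) auto
  then show ?thesis
    using e(1) cvec.span_add[of "x - e" _ e] by (simp add: eigenspan_def)
qed

lemma funpow_linear: "(T ^^ i) ` N \<subseteq> N \<and> clinear_on N (T ^^ i)"
proof (induction i)
  case 0
  then show ?case by (auto simp: clinear_on_def)
next
  case (Suc i)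
  then have "(T ^^ i) x \<in> N" if "x \<in> N" for x
    using that by auto
  with Suc inv lin show ?case
    by (auto simp: clinear_on_def)
qed

text \<open>A linear factor \<open>X - \<mu>\<close> of \<open>p\<close> is absorbed into the vector: the quotient annihilates
  \<open>T x - \<mu> x\<close>, and the previous lemma leads back to \<open>x\<close>.\<close>

lemma annihilated_imp_eigenspan:
  assumes "p \<noteq> 0" "degree p \<le> m" "x \<in> N" "(\<Sum>i\<le>m. coeff p i *\<^sub>C (T ^^ i) x) = 0"
  shows "x \<in> eigenspan N T"
  using assms
proof (induction m arbitrary: p x)
  case 0
  then have "coeff p 0 \<noteq> 0"
    using leading_coeff_0_iff[of p] by simp
  with 0 have "x = 0" by simp
  then show ?case by (simp add: eigenspan_def cvec.span_zero)
next
  case (Suc m)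
  show ?case
  proof (cases "degree p \<le> m")
    case True
    then have "coeff p (Suc m) = 0"
      by (intro coeff_eq_0) simp
    then show ?thesis
      using Suc.IH[of p x] Suc.prems True by simp
  next
    case False
    then have "\<not> constant (poly p)"
      by (simp add: constant_degree)
    then obtain \<mu> where "poly p \<mu> = 0"
      using fundamental_theorem_of_algebra by blast
    then obtain q where q: "p = [:- \<mu>, 1:] * q"
      by (metis poly_eq_0_iff_dvd dvdE)
    have q0: "q \<noteq> 0"
      using Suc.prems(1) q by auto
    then have "degree p = Suc (degree q)"
      using q degree_mult_eq[of "[:- \<mu>, 1:]" q] by (simp del: mult_pCons_left)
    then have deg: "degree q \<le> m"
      using Suc.prems(2) by simp
    then have qm: "coeff q (Suc m) = 0"
      by (intro coeff_eq_0) simp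
    have c0: "coeff p 0 = - \<mu> * coeff q 0" and cS: "\<And>i. coeff p (Suc i) = coeff q i - \<mu> * coeff q (Suc i)"
      by (simp_all add: q coeff_pCons_Suc)
    define z where "z = T x - \<mu> *\<^sub>C x"
    have zN: "z \<in> N"
      unfolding z_def using Suc.prems(3) inv sub cvec.subspace_diff cvec.subspace_scale by blast
    have "(T ^^ i) z = (T ^^ Suc i) x - \<mu> *\<^sub>C (T ^^ i) x" for i
      unfolding z_def funpow_Suc_right using funpow_linear[of i] Suc.prems(3) inv sub
      by (simp add: clinear_on_diff[of N "T ^^ i"] clinear_on_scale[of N "T ^^ i"] cvec.subspace_scale)
    then have "(\<Sum>i\<le>m. coeff q i *\<^sub>C (T ^^ i) z)
        = (\<Sum>i\<le>m. coeff q i *\<^sub>C (T ^^ Suc i) x) - \<mu> *\<^sub>C (\<Sum>i\<le>m. coeff q i *\<^sub>C (T ^^ i) x)"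
      by (simp add: cvec.scale_right_diff_distrib sum_subtractf cvec.scale_sum_right mult.commute)
    also have "(\<Sum>i\<le>m. coeff q i *\<^sub>C (T ^^ i) x) = (\<Sum>i\<le>Suc m. coeff q i *\<^sub>C (T ^^ i) x)"
      using qm by simp
    also have "\<dots> = coeff q 0 *\<^sub>C x + (\<Sum>i\<le>m. coeff q (Suc i) *\<^sub>C (T ^^ Suc i) x)"
      by (subst sum.atMost_Suc_shift) simp
    also have "(\<Sum>i\<le>m. coeff q i *\<^sub>C (T ^^ Suc i) x) - \<mu> *\<^sub>C \<dots> = (\<Sum>i\<le>Suc m. coeff p i *\<^sub>C (T ^^ i) x)"
      by (subst sum.atMost_Suc_shift) (simp add: c0 cS cvec.scale_left_diff_distrib
          cvec.scale_right_distrib sum_subtractf cvec.scale_sum_right algebra_simps)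
    finally have "z \<in> eigenspan N T"
      using Suc.prems(4) Suc.IH[OF q0 deg zN] by simp
    then show ?thesis
      using eigenspan_shift Suc.prems(3) by (simp add: z_def)
  qed
qed

text \<open>More powers of \<open>T\<close> applied to \<open>x\<close> than the number of generators are linearly dependent, which gives an
  annihilating polynomial.\<close>

lemma finite_invariant_imp_eigenspan:
  assumes G: "finite G" "cspan G \<subseteq> N" and TG: "\<And>x. x \<in> cspan G \<Longrightarrow> T x \<in> cspan G" and x: "x \<in> cspan G"
  shows "x \<in> eigenspan N T"
proof -
  define v where "v = (\<lambda>i. (T ^^ i) x)"
  define m where "m = card G"
  have vG: "v i \<in> cspan G" for i
    by (induction i) (auto simp: v_def x TG)
  \<comment> \<open>Dependence is a property of sets, so coinciding powers have to be treated separately.\<close>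
  have "\<exists>c. (\<exists>i\<le>m. c i \<noteq> (0::complex)) \<and> (\<Sum>i\<le>m. c i *\<^sub>C v i) = 0"
  proof (cases "inj_on v {..m}")
    case True
    then have "card (v ` {..m}) = Suc m"
      by (simp add: card_image)
    then have "\<not> cindependent (v ` {..m})"
      using cvec.independent_span_bound[OF G(1), of "v ` {..m}"] vG by (auto simp: m_def)
    then obtain u where "\<exists>w\<in>v ` {..m}. u w \<noteq> 0" "(\<Sum>w\<in>v ` {..m}. u w *\<^sub>C w) = 0"
      using cvec.dependent_finite[of "v ` {..m}"] by auto
    then show ?thesis
      by (intro exI[of _ "\<lambda>i. u (v i)"]) (auto simp: sum.reindex[OF True])
  next
    case False
    then obtain i j where ij: "i \<le> m" "j \<le> m" "i \<noteq> j" "v i = v j"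
      by (auto simp: inj_on_def)
    let ?c = "\<lambda>k. if k = i then 1 else if k = j then -1 else (0::complex)"
    have "(\<Sum>k\<le>m. ?c k *\<^sub>C v k) = (\<Sum>k\<in>{i, j}. ?c k *\<^sub>C v k)"
      using ij by (intro sum.mono_neutral_right) auto
    then show ?thesis
      using ij by (intro exI[of _ ?c]) auto
  qed
  then obtain c i where c: "i \<le> m" "c i \<noteq> (0::complex)" "(\<Sum>i\<le>m. c i *\<^sub>C v i) = 0"
    by blast
  define p where "p = (\<Sum>i\<le>m. monom (c i) i)"
  have coeff: "coeff p k = (if k \<le> m then c k else 0)" for k
    by (simp add: p_def coeff_sum)
  have "p \<noteq> 0"
    using c coeff[of i] by auto
  moreover have "degree p \<le> m"
    by (intro degree_le) (simp add: coeff)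
  ultimately show ?thesis
    using annihilated_imp_eigenspan[of p m x] c(3) x G(2) by (auto simp: coeff v_def)
qed

end

section \<open>Complex Hilbert spaces and closable operators\<close>

lemma cinner_add_left: "cinner (x + y) z = cinner x z + cinner y z"
  by (metis cinner_commute cinner_add_right complex_cnj_add)

lemma cinner_scaleC_left: "cinner (c *\<^sub>C x) y = cnj c * cinner x y"
  by (metis cinner_commute cinner_scaleC_right complex_cnj_mult)

lemma clinear_cinner: "clinear_on UNIV (cinner x)"
  by (rule clinear_onI) (simp_all add: cinner_add_right cinner_scaleC_right)

lemma cinner_sum_right: "cinner x (\<Sum>i\<in>I. f i) = (\<Sum>i\<in>I. cinner x (f i))"
  using clinear_on_sum[OF clinear_cinner, of I f] by simp

lemma cinner_sum_left: "cinner (\<Sum>i\<in>I. f i) x = (\<Sum>i\<in>I. cinner (f i) x)"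
  by (subst cinner_commute, subst cinner_sum_right, subst cnj_sum, intro sum.cong refl)
    (rule cinner_commute[symmetric])

lemma cinner_zero_right [simp]: "cinner x 0 = 0"
  using clinear_on_zero[OF clinear_cinner] by simp

lemma cinner_diff_right: "cinner x (y - z) = cinner x y - cinner x z"
  using clinear_on_diff[OF clinear_cinner, of y z x] by simp

lemma cinner_diff_left: "cinner (x - y) z = cinner x z - cinner y z"
  by (metis cinner_commute cinner_diff_right complex_cnj_diff)

lemma cauchy_schwarz: "cmod (cinner x y) \<le> norm x * norm y"
proof (cases "y = 0")
  case False
  define n where "n = (norm y)\<^sup>2"
  define t where "t = cinner y x"
  have n: "n > 0"
    using False by (simp add: n_def)
  \<comment> \<open>\<open>n\<close> times the component of \<open>x\<close> orthogonal to \<open>y\<close>.\<close>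
  define z where "z = complex_of_real n *\<^sub>C x - t *\<^sub>C y"
  have yy: "cinner y y = complex_of_real n"
    by (simp add: cinner_self n_def)
  have xy: "cinner x y = cnj t"
    unfolding t_def by (rule cinner_commute)
  have yz: "cinner y z = 0"
    by (simp add: z_def cinner_diff_right cinner_scaleC_right yy t_def)
  have "complex_of_real ((norm z)\<^sup>2) = cinner z z"
    by (simp add: cinner_self)
  also have "\<dots> = complex_of_real n * cinner x z"
    by (subst (1) z_def) (simp add: cinner_diff_left cinner_scaleC_left yz)
  also have "cinner x z = complex_of_real (n * (norm x)\<^sup>2) - t * cnj t"
    by (simp add: z_def cinner_diff_right cinner_scaleC_right xy cinner_self)
  also have "t * cnj t = complex_of_real ((cmod t)\<^sup>2)"
    using complex_norm_square[of t] by simp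
  finally have "complex_of_real ((norm z)\<^sup>2) = complex_of_real (n * (n * (norm x)\<^sup>2 - (cmod t)\<^sup>2))"
    by simp
  then have "n * (n * (norm x)\<^sup>2 - (cmod t)\<^sup>2) \<ge> 0"
    by (metis of_real_eq_iff zero_le_power2)
  then have "(cmod t)\<^sup>2 \<le> (norm x * norm y)\<^sup>2"
    using n by (simp add: zero_le_mult_iff n_def power_mult_distrib mult.commute)
  then have "cmod t \<le> norm x * norm y"
    by (rule power2_le_imp_le) simp
  then show ?thesis
    by (simp add: xy)
qed simp

lemma bounded_bilinear_cinner: "bounded_bilinear cinner"
proof
  show "\<exists>K. \<forall>a b. norm (cinner a b) \<le> norm a * norm b * K"
    by (rule exI[of _ 1]) (simp add: cauchy_schwarz)
qed (simp_all add: cinner_add_left cinner_add_right scaleR_eq_scaleC cinner_scaleC_left cinner_scaleC_right)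

lemmas tendsto_cinner = bounded_bilinear.tendsto[OF bounded_bilinear_cinner]

lemma cinner_self_eq_0: "cinner x x = 0 \<Longrightarrow> x = 0"
  by (simp add: cinner_self)

lemma closure_op_graph_iff:
  fixes T :: "'h::complex_normed_vector \<Rightarrow> 'g::complex_normed_vector"
  shows "(v, w) \<in> closure (op_graph D T) \<longleftrightarrow>
    (\<exists>X. (\<forall>n. X n \<in> D) \<and> X \<longlonglongrightarrow> v \<and> (\<lambda>n. T (X n)) \<longlonglongrightarrow> w)"
proof
  assume "(v, w) \<in> closure (op_graph D T)"
  then obtain F where F: "\<forall>n. F n \<in> op_graph D T" "F \<longlonglongrightarrow> (v, w)"
    by (auto simp: closure_sequential)
  then have "fst (F n) \<in> D" "snd (F n) = T (fst (F n))" for n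
    by (auto simp: op_graph_def dest!: spec[of _ n])
  moreover have "(\<lambda>n. fst (F n)) \<longlonglongrightarrow> v" "(\<lambda>n. snd (F n)) \<longlonglongrightarrow> w"
    using tendsto_fst[OF F(2)] tendsto_snd[OF F(2)] by simp_all
  ultimately show "\<exists>X. (\<forall>n. X n \<in> D) \<and> X \<longlonglongrightarrow> v \<and> (\<lambda>n. T (X n)) \<longlonglongrightarrow> w"
    by (intro exI[of _ "\<lambda>n. fst (F n)"]) simp
next
  assume "\<exists>X. (\<forall>n. X n \<in> D) \<and> X \<longlonglongrightarrow> v \<and> (\<lambda>n. T (X n)) \<longlonglongrightarrow> w"
  then obtain X where X: "\<forall>n. X n \<in> D" "X \<longlonglongrightarrow> v" "(\<lambda>n. T (X n)) \<longlonglongrightarrow> w"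
    by blast
  have "(\<lambda>n. (X n, T (X n))) \<longlonglongrightarrow> (v, w)"
    using X by (intro tendsto_Pair)
  then show "(v, w) \<in> closure (op_graph D T)"
    using X(1) unfolding closure_sequential
    by (intro exI[of _ "\<lambda>n. (X n, T (X n))"]) (auto simp: op_graph_def)
qed

text \<open>If \<open>X n\<close> tends to zero and \<open>T (X n)\<close> to \<open>w\<close>, the hypothesis makes \<open>w\<close> orthogonal to the range of \<open>T\<close>.
  As \<open>w\<close> is itself a limit of elements of the range, it vanishes.\<close>

lemma closableI:
  fixes T :: "'h::chilbert_space \<Rightarrow> 'g::chilbert_space"
  assumes sub: "csubspace D" and lin: "clinear_on D T"
    and adj: "\<And>a b. a \<in> D \<Longrightarrow> b \<in> D \<Longrightarrow> cinner (T a) (T b) = cinner a (K b)"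
  shows "closable D T"
  unfolding closable_def
proof (intro conjI allI impI sub lin)
  fix v w w'
  assume "(v, w) \<in> closure (op_graph D T) \<and> (v, w') \<in> closure (op_graph D T)"
  then obtain X Y where X: "\<And>n. X n \<in> D" "X \<longlonglongrightarrow> v" "(\<lambda>n. T (X n)) \<longlonglongrightarrow> w"
    and Y: "\<And>n. Y n \<in> D" "Y \<longlonglongrightarrow> v" "(\<lambda>n. T (Y n)) \<longlonglongrightarrow> w'"
    unfolding closure_op_graph_iff by blast
  define Z where "Z = (\<lambda>n. X n - Y n)"
  have ZD: "Z n \<in> D" for n
    unfolding Z_def by (rule cvec.subspace_diff[OF sub X(1) Y(1)])
  have Z0: "Z \<longlonglongrightarrow> 0"
    using tendsto_diff[OF X(2) Y(2)] by (simp add: Z_def)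
  have TZ: "(\<lambda>n. T (Z n)) \<longlonglongrightarrow> w - w'"
    using tendsto_diff[OF X(3) Y(3)] by (simp add: Z_def clinear_on_diff[OF lin sub X(1) Y(1)])
  have orth: "cinner (w - w') (T b) = 0" if "b \<in> D" for b
  proof -
    have "(\<lambda>n. cinner (T (Z n)) (T b)) \<longlonglongrightarrow> cinner (w - w') (T b)"
      by (intro tendsto_cinner TZ tendsto_const)
    moreover have "(\<lambda>n. cinner (T (Z n)) (T b)) \<longlonglongrightarrow> cinner 0 (K b)"
      unfolding adj[OF ZD that] by (intro tendsto_cinner Z0 tendsto_const)
    moreover have "cinner 0 (K b) = 0"
      using cinner_commute[of 0 "K b"] by simp
    ultimately show ?thesis
      using LIMSEQ_unique by metis
  qed
  have "(\<lambda>n. cinner (w - w') (T (Z n))) \<longlonglongrightarrow> cinner (w - w') (w - w')"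
    by (intro tendsto_cinner TZ tendsto_const)
  then have "cinner (w - w') (w - w') = 0"
    unfolding orth[OF ZD] using LIMSEQ_unique tendsto_const by metis
  then show "w = w'"
    using cinner_self_eq_0 by force
qed

lemma closable_limit:
  assumes "closable D T" "\<And>n. X n \<in> D" "X \<longlonglongrightarrow> v" "(\<lambda>n. T (X n)) \<longlonglongrightarrow> w" "v \<in> D"
  shows "w = T v"
proof -
  have "(v, w) \<in> closure (op_graph D T)"
    unfolding closure_op_graph_iff using assms by blast
  moreover have "(v, T v) \<in> closure (op_graph D T)"
    using assms(5) closure_subset by (fastforce simp: op_graph_def)
  ultimately show ?thesis
    using assms(1) unfolding closable_def by blast
qed

lemma op_closure_eq:
  fixes T :: "'h::complex_normed_vector \<Rightarrow> 'g::complex_normed_vector"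
  assumes "closable D T" "v \<in> D"
  shows "op_closure D T v = T v"
  unfolding op_closure_def
proof (rule the_equality)
  show "(v, T v) \<in> closure (op_graph D T)"
    using assms(2) closure_subset by (fastforce simp: op_graph_def)
  then show "w = T v" if "(v, w) \<in> closure (op_graph D T)" for w
    using that assms(1) unfolding closable_def by blast
qed

text \<open>Along a form-Cauchy sequence the values of \<open>T\<close> are Cauchy, and closability identifies their limit.\<close>

lemma form_closure_eq:
  fixes T :: "'h::complex_normed_vector \<Rightarrow> 'g::chilbert_space"
  assumes T: "closable D T" and q: "\<And>u. u \<in> D \<Longrightarrow> q u = complex_of_real (c * (norm (T u))\<^sup>2)"
    and c: "c > 0" and v: "v \<in> D"
  shows "form_closure D q v = q v"
  unfolding form_closure_def
proof (rule the_equality)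
  have sub: "csubspace D" and lin: "clinear_on D T"
    using T by (auto simp: closable_def)
  have q0: "q 0 = 0"
    using q[OF cvec.subspace_0[OF sub]] clinear_on_zero[OF lin sub] by simp
  show "\<exists>X. (\<forall>n. X n \<in> D) \<and> X \<longlonglongrightarrow> v \<and> (\<forall>r>0. \<exists>N. \<forall>m\<ge>N. \<forall>n\<ge>N. cmod (q (X m - X n)) < r) \<and>
      (\<lambda>n. q (X n)) \<longlonglongrightarrow> q v"
    using v q0 by (intro exI[of _ "\<lambda>_. v"]) simp
  fix e
  assume "\<exists>X. (\<forall>n. X n \<in> D) \<and> X \<longlonglongrightarrow> v \<and> (\<forall>r>0. \<exists>N. \<forall>m\<ge>N. \<forall>n\<ge>N. cmod (q (X m - X n)) < r) \<and>
      (\<lambda>n. q (X n)) \<longlonglongrightarrow> e"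
  then obtain X where X: "\<And>n. X n \<in> D" "X \<longlonglongrightarrow> v"
      "\<forall>r>0. \<exists>N. \<forall>m\<ge>N. \<forall>n\<ge>N. cmod (q (X m - X n)) < r" "(\<lambda>n. q (X n)) \<longlonglongrightarrow> e"
    by blast
  have "Cauchy (\<lambda>n. T (X n))"
  proof (rule CauchyI)
    fix r :: real assume r: "r > 0"
    then have "c * r\<^sup>2 > 0" using c by simp
    then obtain N where N: "\<forall>m\<ge>N. \<forall>n\<ge>N. cmod (q (X m - X n)) < c * r\<^sup>2"
      using X(3) by blast
    have "norm (T (X m) - T (X n)) < r" if "m \<ge> N" "n \<ge> N" for m n
    proof -
      have "cmod (q (X m - X n)) = c * (norm (T (X m) - T (X n)))\<^sup>2"
        using q[OF cvec.subspace_diff[OF sub X(1) X(1), of m n]] c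
        by (simp add: clinear_on_diff[OF lin sub X(1) X(1)] norm_mult norm_power)
      then have "(norm (T (X m) - T (X n)))\<^sup>2 < r\<^sup>2"
        using N that c by (metis mult_less_cancel_left_pos)
      then show ?thesis
        using r by (simp add: power2_less_imp_less)
    qed
    then show "\<exists>M. \<forall>m\<ge>M. \<forall>n\<ge>M. norm (T (X m) - T (X n)) < r" by blast
  qed
  then obtain w where w: "(\<lambda>n. T (X n)) \<longlonglongrightarrow> w"
    using Cauchy_convergent convergent_def by blast
  then have w_eq: "w = T v"
    using closable_limit[OF T X(1,2) _ v] by blast
  have "(\<lambda>n. q (X n)) \<longlonglongrightarrow> q v"
    unfolding q[OF X(1)] q[OF v] by (intro tendsto_intros w[unfolded w_eq])
  then show "e = q v"
    using X(4) LIMSEQ_unique by blast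
qed

section \<open>The dense Hopf *-algebra\<close>

lemma star_zero [simp]: "star (0::'a::cstar_algebra) = 0"
  using star_add[of 0 "0::'a"] by simp

lemma star_one [simp]: "star (1::'a::cstar_algebra) = 1"
  by (metis mult_1 mult_1_right star_mult star_star)

lemma star_minus: "star (- x) = - star (x::'a::cstar_algebra)"
  using star_add[of x "- x"] by (simp add: eq_neg_iff_add_eq_0 add.commute)

lemma star_diff: "star (x - y) = star x - star (y::'a::cstar_algebra)"
  using star_add[of x "- y"] by (simp add: star_minus)

lemma star_sum: "star (\<Sum>i\<in>I. f i) = (\<Sum>i\<in>I. star (f i :: 'a::cstar_algebra))"
  by (induction I rule: infinite_finite_induct) (simp_all add: star_add)

lemma sum_lessThan_mult:
  fixes f :: "nat \<Rightarrow> nat \<Rightarrow> 'b::comm_monoid_add"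
  shows "(\<Sum>p<n * m. f (p div m) (p mod m)) = (\<Sum>i<n. \<Sum>k<m. f i k)"
proof (cases "m = 0")
  case False
  have "(\<Sum>p<n * m. f (p div m) (p mod m)) = (\<Sum>(i, k)\<in>{..<n} \<times> {..<m}. f i k)"
  proof (rule sum.reindex_bij_witness[where i = "\<lambda>(i, k). i * m + k" and j = "\<lambda>p. (p div m, p mod m)"])
    fix ik assume "ik \<in> {..<n} \<times> {..<m}"
    then obtain i k where ik: "ik = (i, k)" "i < n" "k < m" by auto
    have "i * m + k < Suc i * m" using ik by simp
    also have "\<dots> \<le> n * m" using ik by (intro mult_right_mono) auto
    finally show "(case ik of (i, k) \<Rightarrow> i * m + k) \<in> {..<n * m}" by (simp add: ik)
    show "((case ik of (i, k) \<Rightarrow> i * m + k) div m, (case ik of (i, k) \<Rightarrow> i * m + k) mod m) = ik"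
      using ik by simp
  qed (use False in \<open>auto simp: less_mult_imp_div_less\<close>)
  then show ?thesis
    by (simp add: sum.cartesian_product)
qed simp

locale cqg_hopf =
  fixes \<tau> :: "'a::cstar_algebra \<Rightarrow> 'a \<Rightarrow> 't::cstar_algebra"
    and \<Delta> :: "'a \<Rightarrow> 't"
    and \<epsilon> h :: "'a \<Rightarrow> complex"
    and S :: "'a \<Rightarrow> 'a"
  assumes tensor: "cstar_min_tensor \<tau>"
    and comult_hom: "star_hom \<Delta>"
    and counit: "is_counit \<tau> \<Delta> \<epsilon>"
    and antipode: "is_antipode \<tau> \<Delta> \<epsilon> S"
    and haar: "is_haar_state \<tau> \<Delta> h"
    and faithful: "faithful_state h"
begin

sublocale tensor: cstar_min_tensor \<tau>
  by (rule tensor)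

abbreviation M :: "'a set" where "M \<equiv> hopf_core \<tau> \<Delta>"

lemma \<tau>_linear: "clinear_on UNIV (\<tau> a)" "clinear_on UNIV (\<lambda>a. \<tau> a b)"
  using tensor.bilinear by (simp_all add: cbilinear_def)

lemma \<tau>_simps: "\<tau> (a + a') b = \<tau> a b + \<tau> a' b" "\<tau> a (b + b') = \<tau> a b + \<tau> a b'"
    "\<tau> (c *\<^sub>C a) b = c *\<^sub>C \<tau> a b" "\<tau> a (c *\<^sub>C b) = c *\<^sub>C \<tau> a b"
  using \<tau>_linear unfolding clinear_on_def by auto

lemma \<Delta>_linear: "clinear_on UNIV \<Delta>"
  using comult_hom by (simp add: star_hom_def)

lemma \<Delta>_simps: "\<Delta> 1 = 1" "\<Delta> (a * b) = \<Delta> a * \<Delta> b" "\<Delta> (star a) = star (\<Delta> a)"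
    "\<Delta> (a + b) = \<Delta> a + \<Delta> b" "\<Delta> (c *\<^sub>C a) = c *\<^sub>C \<Delta> a"
  using comult_hom by (simp_all add: star_hom_def clinear_on_def)

lemma M_subspace: "csubspace M"
  by (simp add: hopf_core_def cvec.subspace_span)

lemmas M_scale = cvec.subspace_scale[OF M_subspace]
lemmas M_add = cvec.subspace_add[OF M_subspace]
lemmas M_diff = cvec.subspace_diff[OF M_subspace]
lemmas M_zero = cvec.subspace_0[OF M_subspace]

definition coeffs :: "'a set" where
  "coeffs = {u i j |n u i j. unitary_corep \<tau> \<Delta> n u \<and> i < n \<and> j < n}"

lemma M_eq: "M = cspan coeffs"
  by (simp add: hopf_core_def coeffs_def)

lemma coeffs_subset: "coeffs \<subseteq> M"
  unfolding M_eq by (rule cvec.span_superset)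

lemma coeff_in_M: "unitary_corep \<tau> \<Delta> n u \<Longrightarrow> i < n \<Longrightarrow> j < n \<Longrightarrow> u i j \<in> M"
  using coeffs_subset unfolding coeffs_def by blast

lemma corep_\<Delta>: "unitary_corep \<tau> \<Delta> n u \<Longrightarrow> i < n \<Longrightarrow> j < n \<Longrightarrow> \<Delta> (u i j) = (\<Sum>k<n. \<tau> (u i k) (u k j))"
  and corep_right: "unitary_corep \<tau> \<Delta> n u \<Longrightarrow> i < n \<Longrightarrow> j < n \<Longrightarrow>
      (\<Sum>k<n. u i k * star (u j k)) = (if i = j then 1 else 0)"
  and corep_left: "unitary_corep \<tau> \<Delta> n u \<Longrightarrow> i < n \<Longrightarrow> j < n \<Longrightarrow>
      (\<Sum>k<n. star (u k i) * u k j) = (if i = j then 1 else 0)"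
  by (simp_all add: unitary_corep_def)

lemma M_induct [consumes 1, case_names coeff zero add scale]:
  assumes "a \<in> M"
    and "\<And>n u i j. unitary_corep \<tau> \<Delta> n u \<Longrightarrow> i < n \<Longrightarrow> j < n \<Longrightarrow> P (u i j)"
    and "P 0" and "\<And>a b. a \<in> M \<Longrightarrow> b \<in> M \<Longrightarrow> P a \<Longrightarrow> P b \<Longrightarrow> P (a + b)"
    and "\<And>c a. a \<in> M \<Longrightarrow> P a \<Longrightarrow> P (c *\<^sub>C a)"
  shows "P a"
proof -
  have "P a \<and> a \<in> M"
    using assms(1) unfolding M_eq
  proof (induction rule: cvec.span_induct_alt)
    case base
    then show ?case by (simp add: assms(3) cvec.span_zero)
  next
    case (step c x y)
    then have "P x"
      using assms(2) by (auto simp: coeffs_def)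
    moreover have "x \<in> cspan coeffs"
      using step by (intro cvec.span_base)
    ultimately show ?case
      using step assms(4)[of "c *\<^sub>C x" y] assms(5)[of x c] cvec.span_scale[of x coeffs c]
      by (simp add: M_eq cvec.span_add)
  qed
  then show ?thesis ..
qed

lemma one_in_M: "1 \<in> M"
proof -
  have "unitary_corep \<tau> \<Delta> 1 (\<lambda>_ _. 1)"
    by (simp add: unitary_corep_def \<Delta>_simps tensor.unit)
  then show ?thesis
    using coeff_in_M[of 1 "\<lambda>_ _. 1" 0 0] by simp
qed

text \<open>This is the tensor product of two corepresentations; the index pair \<open>(i, k)\<close> is encoded as
  \<open>i * m + k\<close>.\<close>

lemma M_mult_corep:
  assumes u: "unitary_corep \<tau> \<Delta> n u" and v: "unitary_corep \<tau> \<Delta> m v"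
  shows "unitary_corep \<tau> \<Delta> (n * m) (\<lambda>p q. u (p div m) (q div m) * v (p mod m) (q mod m))"
  unfolding unitary_corep_def
proof (intro allI impI)
  fix p q assume "p < n * m" "q < n * m"
  then have m: "m > 0" and p: "p div m < n" "p mod m < m" and q: "q div m < n" "q mod m < m"
    by (auto simp: less_mult_imp_div_less intro!: mod_less_divisor gr0I)
  define i k j l where ij: "i = p div m" "k = p mod m" "j = q div m" "l = q mod m"
  have pq: "p = q \<longleftrightarrow> i = j \<and> k = l"
    unfolding ij by (metis div_mult_mod_eq)
  have b: "i < n" "k < m" "j < n" "l < m"
    using p q by (simp_all add: ij)
  have "\<Delta> (u i j * v k l) = (\<Sum>a<n. \<Sum>b<m. \<tau> (u i a * v k b) (u a j * v b l))"
    using b by (simp add: \<Delta>_simps corep_\<Delta>[OF u] corep_\<Delta>[OF v] sum_product tensor.mult)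
  also have "\<dots> = (\<Sum>r<n * m. \<tau> (u i (r div m) * v k (r mod m)) (u (r div m) j * v (r mod m) l))"
    by (rule sum_lessThan_mult[symmetric])
  finally have 1: "\<Delta> (u i j * v k l) = \<dots>" .
  have "(\<Sum>r<n * m. (u i (r div m) * v k (r mod m)) * star (u j (r div m) * v l (r mod m)))
      = (\<Sum>a<n. \<Sum>b<m. u i a * (v k b * star (v l b)) * star (u j a))"
    unfolding sum_lessThan_mult[symmetric] by (simp add: star_mult mult.assoc)
  also have "\<dots> = (\<Sum>a<n. u i a * (\<Sum>b<m. v k b * star (v l b)) * star (u j a))"
    by (simp add: sum_distrib_left sum_distrib_right)
  also have "\<dots> = (if p = q then 1 else 0)"
    using b pq by (simp add: corep_right[OF v] corep_right[OF u])
  finally have 2: "(\<Sum>r<n * m. (u i (r div m) * v k (r mod m)) * star (u j (r div m) * v l (r mod m))) = \<dots>" .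
  have "(\<Sum>r<n * m. star (u (r div m) i * v (r mod m) k) * (u (r div m) j * v (r mod m) l))
      = (\<Sum>a<n. \<Sum>b<m. star (v b k) * (star (u a i) * u a j) * v b l)"
    unfolding sum_lessThan_mult[symmetric] by (simp add: star_mult mult.assoc)
  also have "\<dots> = (\<Sum>b<m. \<Sum>a<n. star (v b k) * (star (u a i) * u a j) * v b l)"
    by (rule sum.swap)
  also have "\<dots> = (\<Sum>b<m. star (v b k) * (\<Sum>a<n. star (u a i) * u a j) * v b l)"
    by (simp add: sum_distrib_left sum_distrib_right)
  also have "\<dots> = (if p = q then 1 else 0)"
    using b pq by (simp add: corep_left[OF v] corep_left[OF u])
  finally have 3: "(\<Sum>r<n * m. star (u (r div m) i * v (r mod m) k) * (u (r div m) j * v (r mod m) l)) = \<dots>" .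
  show "\<Delta> (u (p div m) (q div m) * v (p mod m) (q mod m)) = (\<Sum>r<n * m.
        \<tau> (u (p div m) (r div m) * v (p mod m) (r mod m)) (u (r div m) (q div m) * v (r mod m) (q mod m))) \<and>
      (\<Sum>r<n * m. u (p div m) (r div m) * v (p mod m) (r mod m) *
        star (u (q div m) (r div m) * v (q mod m) (r mod m))) = (if p = q then 1 else 0) \<and>
      (\<Sum>r<n * m. star (u (r div m) (p div m) * v (r mod m) (p mod m)) *
        (u (r div m) (q div m) * v (r mod m) (q mod m))) = (if p = q then 1 else 0)"
    using 1 2 3 by (simp add: ij)
qed

lemma M_mult:
  assumes a: "a \<in> M" and b: "b \<in> M"
  shows "a * b \<in> M"
proof -
  have gen: "u i j * v k l \<in> M" if u: "unitary_corep \<tau> \<Delta> n u" "i < n" "j < n"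
    and v: "unitary_corep \<tau> \<Delta> m v" "k < m" "l < m" for n u i j m v k l
  proof -
    have *: "i * m + k < n * m" if "i < n" "k < m" for i k :: nat
    proof -
      have "i * m + k < Suc i * m" using that by simp
      also have "\<dots> \<le> n * m" using that by (intro mult_right_mono) auto
      finally show ?thesis .
    qed
    show ?thesis
      using coeff_in_M[OF M_mult_corep[OF u(1) v(1)], of "i * m + k" "j * m + l"] * u v by simp
  qed
  have left: "a * v k l \<in> M" if v: "unitary_corep \<tau> \<Delta> m v" "k < m" "l < m" for m v k l
    using a
  proof (induction rule: M_induct)
    case (coeff n u i j)
    then show ?case using gen v by blast
  qed (auto simp: M_zero M_add M_scale distrib_right mult_scaleC_left)
  show ?thesis
    using b by (induction rule: M_induct)
      (auto simp: left M_zero M_add M_scale distrib_left mult_scaleC_right)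
qed

lemma cbilinear_scaleC:
  fixes F :: "'a \<Rightarrow> 'v::complex_normed_vector"
  assumes "clinear_on N f" "clinear_on N F"
  shows "cbilinear_on N (\<lambda>x y. f x *\<^sub>C F y)" "cbilinear_on N (\<lambda>x y. f y *\<^sub>C F x)"
  using assms by (simp_all add: cbilinear_on_def clinear_on_def cvec.scale_left_distrib
      cvec.scale_right_distrib mult.commute)

lemma cbilinear_mult:
  assumes "clinear_on N f" "clinear_on N g"
  shows "cbilinear_on N (\<lambda>x y. f x * (g y :: 'a))"
  using assms by (simp_all add: cbilinear_on_def clinear_on_def distrib_left distrib_right
      mult_scaleC_left mult_scaleC_right)

lemma clinear_id: "clinear_on N (\<lambda>x. x)"
  by (simp add: clinear_on_def)

lemma cbilinear_comp:
  assumes "cbilinear_on M B" "clinear_on N f" "\<And>x y. x \<in> M \<Longrightarrow> y \<in> M \<Longrightarrow> B x y \<in> N"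
  shows "cbilinear_on M (\<lambda>x y. f (B x y))"
  using assms by (simp add: cbilinear_on_def clinear_on_def)

section \<open>Sweedler notation\<close>

lemma bilinear_sums_eq:
  fixes I :: "'i set" and J :: "'j set" and B :: "'a \<Rightarrow> 'a \<Rightarrow> 'v::complex_normed_vector"
  assumes B: "cbilinear_on M B"
    and I: "finite I" "\<And>i. i \<in> I \<Longrightarrow> x i \<in> M \<and> y i \<in> M"
    and J: "finite J" "\<And>j. j \<in> J \<Longrightarrow> x' j \<in> M \<and> y' j \<in> M"
    and eq: "(\<Sum>i\<in>I. \<tau> (x i) (y i)) = (\<Sum>j\<in>J. \<tau> (x' j) (y' j))"
  shows "(\<Sum>i\<in>I. B (x i) (y i)) = (\<Sum>j\<in>J. B (x' j) (y' j))"
proof -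
  let ?x = "case_sum x (\<lambda>j. - x' j)" and ?y = "case_sum y y'"
  have split: "(\<Sum>k\<in>I <+> J. F (?x k) (?y k)) = (\<Sum>i\<in>I. F (x i) (y i)) - (\<Sum>j\<in>J. F (x' j) (y' j))"
    if "\<And>j. j \<in> J \<Longrightarrow> F (- x' j) (y' j) = - F (x' j) (y' j)" for F :: "'a \<Rightarrow> 'a \<Rightarrow> 'w::complex_normed_vector"
    using I(1) J(1) that by (simp add: sum.Plus sum_negf)
  have "\<tau> (- a) b = - \<tau> a b" for a b
    using clinear_on_neg[OF \<tau>_linear(2)] by simp
  then have "(\<Sum>k\<in>I <+> J. \<tau> (?x k) (?y k)) = 0"
    using eq by (subst split) simp_all
  then have "(\<Sum>k\<in>I <+> J. B (?x k) (?y k)) = 0"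
    using I J B cvec.subspace_neg[OF M_subspace]
    by (intro tensor.tensor_zero_imp_bilinear_zero[where N = M and N' = M and B = B])
      (auto simp: M_subspace cbilinear_on_def)
  moreover have "B (- x' j) (y' j) = - B (x' j) (y' j)" if "j \<in> J" for j
    using B J(2)[OF that] clinear_on_neg[of M "\<lambda>a. B a (y' j)" "x' j"] by (auto simp: cbilinear_on_def)
  ultimately show ?thesis
    using split[of B] by simp
qed

text \<open>The value may be computed from any decomposition of \<open>\<Delta> a\<close>, indexed by an arbitrary finite set. Product and
  sum index sets are therefore available when decompositions are combined.\<close>

lemma sweedler_eq:
  fixes I :: "'i set" and B :: "'a \<Rightarrow> 'a \<Rightarrow> 'v::complex_normed_vector"
  assumes B: "cbilinear_on M B" and I: "finite I" "\<And>i. i \<in> I \<Longrightarrow> x i \<in> M \<and> y i \<in> M"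
    and eq: "\<Delta> a = (\<Sum>i\<in>I. \<tau> (x i) (y i))"
  shows "sweedler \<tau> \<Delta> B a = (\<Sum>i\<in>I. B (x i) (y i))"
  unfolding sweedler_def tensor_lift_def
proof (rule the_equality)
  obtain e where e: "bij_betw e {0..<card I} I"
    using ex_bij_betw_nat_finite[OF I(1)] by blast
  then have reindex: "(\<Sum>i<card I. f (e i)) = (\<Sum>i\<in>I. f i)" for f :: "'i \<Rightarrow> 'w::comm_monoid_add"
    using sum.reindex_bij_betw[OF e, of f] by (simp add: atLeast0LessThan)
  have "e i \<in> I" if "i < card I" for i
    using e that by (auto simp: bij_betw_def)
  then show "\<exists>(n::nat) xa ya. (\<forall>i<n. xa i \<in> M \<and> ya i \<in> M) \<and> \<Delta> a = (\<Sum>i<n. \<tau> (xa i) (ya i)) \<and>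
      (\<Sum>i\<in>I. B (x i) (y i)) = (\<Sum>i<n. B (xa i) (ya i))"
    using I(2) by (intro exI[of _ "card I"] exI[of _ "\<lambda>i. x (e i)"] exI[of _ "\<lambda>i. y (e i)"])
      (simp add: eq reindex[of "\<lambda>i. \<tau> (x i) (y i)"] reindex[of "\<lambda>i. B (x i) (y i)"])
  show "v = (\<Sum>i\<in>I. B (x i) (y i))"
    if "\<exists>(n::nat) xa ya. (\<forall>i<n. xa i \<in> M \<and> ya i \<in> M) \<and> \<Delta> a = (\<Sum>i<n. \<tau> (xa i) (ya i)) \<and>
      v = (\<Sum>i<n. B (xa i) (ya i))" for v
  proof -
    from that obtain n :: nat and xa ya where n: "\<forall>i<n. xa i \<in> M \<and> ya i \<in> M"
        "\<Delta> a = (\<Sum>i<n. \<tau> (xa i) (ya i))" "v = (\<Sum>i<n. B (xa i) (ya i))"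
      by blast
    show ?thesis
      unfolding n(3) using n(1,2) I eq by (intro bilinear_sums_eq[OF B]) auto
  qed
qed

lemma sweedler_coeff:
  assumes "unitary_corep \<tau> \<Delta> n u" "i < n" "j < n" "cbilinear_on M B"
  shows "sweedler \<tau> \<Delta> B (u i j) = (\<Sum>k<n. B (u i k) (u k j))"
  using assms by (intro sweedler_eq) (auto simp: corep_\<Delta> coeff_in_M)

lemma \<Delta>_in_span:
  assumes "a \<in> M"
  shows "\<Delta> a \<in> cspan {\<tau> x y |x y. x \<in> M \<and> y \<in> M}"
  using assms
proof (induction rule: M_induct)
  case (coeff n u i j)
  then show ?case
    unfolding corep_\<Delta>[OF coeff]
    by (intro cvec.span_sum, intro cvec.span_base) (use coeff coeff_in_M in blast)
qed (use clinear_on_zero[OF \<Delta>_linear] in \<open>auto simp: \<Delta>_simps intro: cvec.span_zero cvec.span_add cvec.span_scale\<close>)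

lemma sweedler_family:
  assumes "a \<in> M"
  obtains I :: "'t set" and x y where "finite I" "\<And>i. i \<in> I \<Longrightarrow> x i \<in> M \<and> y i \<in> M"
    "\<Delta> a = (\<Sum>i\<in>I. \<tau> (x i) (y i))"
proof -
  obtain I c where I: "finite I" "I \<subseteq> {\<tau> x y |x y. x \<in> M \<and> y \<in> M}" "\<Delta> a = (\<Sum>t\<in>I. c t *\<^sub>C t)"
    using \<Delta>_in_span[OF assms] unfolding cvec.span_explicit by auto
  have "\<forall>t\<in>I. \<exists>x y. t = \<tau> x y \<and> x \<in> M \<and> y \<in> M"
    using I(2) by blast
  then obtain x y where xy: "\<And>t. t \<in> I \<Longrightarrow> t = \<tau> (x t) (y t) \<and> x t \<in> M \<and> y t \<in> M"
    by metis
  have "\<Delta> a = (\<Sum>t\<in>I. \<tau> (c t *\<^sub>C x t) (y t))"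
    unfolding I(3) \<tau>_simps using xy by (intro sum.cong) auto
  then show ?thesis
    using I(1) xy by (intro that[of I "\<lambda>t. c t *\<^sub>C x t" y]) (auto simp: M_scale)
qed

lemma sweedler_linear:
  fixes B :: "'a \<Rightarrow> 'a \<Rightarrow> 'v::complex_normed_vector"
  assumes B: "cbilinear_on M B"
  shows "clinear_on M (sweedler \<tau> \<Delta> B)"
proof (rule clinear_onI)
  fix a b assume "a \<in> M" "b \<in> M"
  obtain I :: "'t set" and x y where I: "finite I" "\<And>i. i \<in> I \<Longrightarrow> x i \<in> M \<and> y i \<in> M"
      "\<Delta> a = (\<Sum>i\<in>I. \<tau> (x i) (y i))"
    using sweedler_family[OF \<open>a \<in> M\<close>] by blast
  obtain J :: "'t set" and x' y' where J: "finite J" "\<And>i. i \<in> J \<Longrightarrow> x' i \<in> M \<and> y' i \<in> M"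
      "\<Delta> b = (\<Sum>i\<in>J. \<tau> (x' i) (y' i))"
    using sweedler_family[OF \<open>b \<in> M\<close>] by blast
  have "sweedler \<tau> \<Delta> B (a + b) = (\<Sum>k\<in>I <+> J. B (case_sum x x' k) (case_sum y y' k))"
    using I J by (intro sweedler_eq[OF B]) (auto simp: \<Delta>_simps sum.Plus)
  then show "sweedler \<tau> \<Delta> B (a + b) = sweedler \<tau> \<Delta> B a + sweedler \<tau> \<Delta> B b"
    using I J by (simp add: sum.Plus sweedler_eq[OF B I] sweedler_eq[OF B J])
next
  fix c a assume "a \<in> M"
  obtain I :: "'t set" and x y where I: "finite I" "\<And>i. i \<in> I \<Longrightarrow> x i \<in> M \<and> y i \<in> M"
      "\<Delta> a = (\<Sum>i\<in>I. \<tau> (x i) (y i))"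
    using sweedler_family[OF \<open>a \<in> M\<close>] by blast
  have "sweedler \<tau> \<Delta> B (c *\<^sub>C a) = (\<Sum>i\<in>I. B (c *\<^sub>C x i) (y i))"
    using I by (intro sweedler_eq[OF B]) (auto simp: \<Delta>_simps \<tau>_simps M_scale cvec.scale_sum_right)
  also have "\<dots> = (\<Sum>i\<in>I. c *\<^sub>C B (x i) (y i))"
    using B I by (intro sum.cong) (auto simp: cbilinear_on_def clinear_on_def)
  finally show "sweedler \<tau> \<Delta> B (c *\<^sub>C a) = c *\<^sub>C sweedler \<tau> \<Delta> B a"
    by (simp add: sweedler_eq[OF B I] cvec.scale_sum_right)
qed

lemma sweedler_mem:
  assumes "cbilinear_on M B" "\<And>x y. x \<in> M \<Longrightarrow> y \<in> M \<Longrightarrow> B x y \<in> N" "csubspace N" "a \<in> M"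
  shows "sweedler \<tau> \<Delta> B a \<in> N"
proof -
  obtain I :: "'t set" and x y where I: "finite I" "\<And>i. i \<in> I \<Longrightarrow> x i \<in> M \<and> y i \<in> M"
      "\<Delta> a = (\<Sum>i\<in>I. \<tau> (x i) (y i))"
    using sweedler_family[OF assms(4)] by blast
  have "sweedler \<tau> \<Delta> B a = (\<Sum>i\<in>I. B (x i) (y i))"
    by (rule sweedler_eq[OF assms(1) I])
  also have "\<dots> \<in> N"
    using assms(2) I(2) by (intro cvec.subspace_sum[OF assms(3)]) auto
  finally show ?thesis .
qed

lemma sweedler_comp:
  assumes "cbilinear_on M B" "clinear_on N f" "csubspace N" "\<And>x y. x \<in> M \<Longrightarrow> y \<in> M \<Longrightarrow> B x y \<in> N" "a \<in> M"
  shows "f (sweedler \<tau> \<Delta> B a) = sweedler \<tau> \<Delta> (\<lambda>x y. f (B x y)) a"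
proof -
  obtain I :: "'t set" and x y where I: "finite I" "\<And>i. i \<in> I \<Longrightarrow> x i \<in> M \<and> y i \<in> M"
      "\<Delta> a = (\<Sum>i\<in>I. \<tau> (x i) (y i))"
    using sweedler_family[OF assms(5)] by blast
  have "f (sweedler \<tau> \<Delta> B a) = f (\<Sum>i\<in>I. B (x i) (y i))"
    by (rule arg_cong[OF sweedler_eq[OF assms(1) I]])
  also have "\<dots> = (\<Sum>i\<in>I. f (B (x i) (y i)))"
    using assms(4) I(2) by (intro clinear_on_sum[OF assms(2,3)]) auto
  also have "\<dots> = sweedler \<tau> \<Delta> (\<lambda>x y. f (B x y)) a"
    by (rule sweedler_eq[OF cbilinear_comp[OF assms(1,2,4)] I, symmetric])
  finally show ?thesis .
qed

lemma sweedler_cong: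
  assumes "\<And>x y. x \<in> M \<Longrightarrow> y \<in> M \<Longrightarrow> B x y = B' x y"
  shows "sweedler \<tau> \<Delta> B a = sweedler \<tau> \<Delta> B' a"
  unfolding sweedler_def tensor_lift_def
proof (rule arg_cong[of _ _ The], rule ext, intro ex_cong1 conj_cong refl)
  fix v and n :: nat and x y
  assume "\<forall>i<n. x i \<in> M \<and> y i \<in> M"
  then have "(\<Sum>i<n. B (x i) (y i)) = (\<Sum>i<n. B' (x i) (y i))"
    using assms by (intro sum.cong) auto
  then show "(v = (\<Sum>i<n. B (x i) (y i))) = (v = (\<Sum>i<n. B' (x i) (y i)))" by simp
qed

section \<open>Counit, antipode and Haar state\<close>

lemma \<epsilon>_linear: "clinear_on M \<epsilon>"
  using counit by (simp add: is_counit_def)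

lemma counit_left: "a \<in> M \<Longrightarrow> sweedler \<tau> \<Delta> (\<lambda>x y. \<epsilon> x *\<^sub>C y) a = a"
  and counit_right: "a \<in> M \<Longrightarrow> sweedler \<tau> \<Delta> (\<lambda>x y. \<epsilon> y *\<^sub>C x) a = a"
  using counit by (simp_all add: is_counit_def)

lemma S_linear: "clinear_on M S" and S_in_M: "a \<in> M \<Longrightarrow> S a \<in> M"
  and antipode_left: "a \<in> M \<Longrightarrow> sweedler \<tau> \<Delta> (\<lambda>x y. S x * y) a = \<epsilon> a *\<^sub>C 1"
  using antipode by (auto simp: is_antipode_def)

lemma state: "is_state h"
  using haar by (simp add: is_haar_state_def)

lemma h_linear: "clinear_on UNIV h"
  using state by (simp add: is_state_def)

lemma h_simps: "h (a + b) = h a + h b" "h (c *\<^sub>C a) = c * h a" "h (a - b) = h a - h b" "h 0 = 0" "h 1 = 1"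
    "h (- a) = - h a"
  using h_linear clinear_on_diff[OF h_linear] clinear_on_neg[OF h_linear] clinear_on_zero[OF h_linear] state
  by (auto simp: clinear_on_def is_state_def)

lemma h_sum: "h (\<Sum>i\<in>I. f i) = (\<Sum>i\<in>I. h (f i))"
  using clinear_on_sum[OF h_linear, of I f] by simp

lemma h_mult_linear: "clinear_on N (\<lambda>x. h (x * b))" "clinear_on N (\<lambda>x. h (a * x))"
  by (simp_all add: clinear_on_def h_simps distrib_left distrib_right mult_scaleC_left mult_scaleC_right)

lemma h_pos: "\<exists>r\<ge>0. h (star a * a) = complex_of_real r"
  using state nonneg_Reals_cases unfolding is_state_def by metis

lemma faithful_left: "h (star a * a) = 0 \<Longrightarrow> a = 0"
  using faithful by (simp add: faithful_state_def)

lemma haar_left_invariance: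
  assumes "\<Delta> a = (\<Sum>k\<in>K. \<tau> (x k) (y k))"
  shows "(\<Sum>k\<in>K. h (x k) *\<^sub>C y k) = h a *\<^sub>C 1"
proof -
  obtain E where E: "clinear_on UNIV E" "\<And>a b. E (\<tau> a b) = h a *\<^sub>C b" "E (\<Delta> a) = h a *\<^sub>C 1"
    using haar unfolding is_haar_state_def by blast
  show ?thesis
    using E(3) clinear_on_sum[OF E(1), of K "\<lambda>k. \<tau> (x k) (y k)"] by (simp add: assms E(2))
qed

text \<open>A row vector multiplied by the invertible matrix \<open>u\<close> determines the row vector. The lemma evaluates the counit
  both on coefficients and on their adjoints.\<close>

lemma corep_row_eq_unit:
  assumes u: "unitary_corep \<tau> \<Delta> n u" and i: "i < n" and l: "l < n"
    and "\<And>j. j < n \<Longrightarrow> (\<Sum>k<n. c k *\<^sub>C u k j) = u i j"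
  shows "c l = (if i = l then 1 else 0)"
proof -
  have "(if i = l then 1 else 0) = (\<Sum>j<n. u i j * star (u l j))"
    using i l by (simp add: corep_right[OF u])
  also have "\<dots> = (\<Sum>j<n. \<Sum>k<n. c k *\<^sub>C (u k j * star (u l j)))"
    using assms(4) by (intro sum.cong) (simp_all flip: sum_distrib_right mult_scaleC_left)
  also have "\<dots> = (\<Sum>k<n. \<Sum>j<n. c k *\<^sub>C (u k j * star (u l j)))"
    by (rule sum.swap)
  also have "\<dots> = (\<Sum>k<n. c k *\<^sub>C (if k = l then 1 else 0))"
    using l by (intro sum.cong) (simp_all add: corep_right[OF u, symmetric] cvec.scale_sum_right)
  also have "\<dots> = c l *\<^sub>C 1"
    using l by (simp add: if_distrib[of "\<lambda>x. _ *\<^sub>C x"] cong: if_cong)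
  finally have "c l *\<^sub>C 1 = (if i = l then 1 else 0) *\<^sub>C (1::'a)"
    by (cases "i = l") (simp_all del: cvec.scale_cancel_right)
  then show ?thesis
    unfolding cvec.scale_cancel_right by simp
qed

lemma \<epsilon>_coeff:
  assumes "unitary_corep \<tau> \<Delta> n u" "i < n" "j < n"
  shows "\<epsilon> (u i j) = (if i = j then 1 else 0)"
proof (rule corep_row_eq_unit[OF assms(1-3)])
  fix l assume "l < n"
  then have "(\<Sum>k<n. \<epsilon> (u i k) *\<^sub>C u k l) = sweedler \<tau> \<Delta> (\<lambda>x y. \<epsilon> x *\<^sub>C y) (u i l)"
    using assms by (intro sweedler_coeff[symmetric] cbilinear_scaleC \<epsilon>_linear clinear_id)
  then show "(\<Sum>k<n. \<epsilon> (u i k) *\<^sub>C u k l) = u i l"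
    using \<open>l < n\<close> assms by (simp add: counit_left coeff_in_M)
qed

lemma \<epsilon>_one: "\<epsilon> 1 = 1"
proof -
  have "unitary_corep \<tau> \<Delta> 1 (\<lambda>_ _. 1)"
    by (simp add: unitary_corep_def \<Delta>_simps tensor.unit)
  then show ?thesis
    using \<epsilon>_coeff[of 1 "\<lambda>_ _. 1" 0 0] by simp
qed

text \<open>Both \<open>S(u)\<close> and \<open>u\<^sup>*\<close> are left inverses of the invertible matrix \<open>u\<close>.\<close>

lemma S_coeff:
  assumes u: "unitary_corep \<tau> \<Delta> n u" and i: "i < n" and l: "l < n"
  shows "S (u i l) = star (u l i)"
proof -
  have eq: "(\<Sum>k<n. S (u i k) * u k j) = (if i = j then 1 else 0)" if "j < n" for j
    using antipode_left[OF coeff_in_M[OF u i that]] \<epsilon>_coeff[OF u i that]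
    by (subst (asm) sweedler_coeff[OF u i that]) (auto intro: cbilinear_mult S_linear clinear_id)
  have "S (u i l) = (\<Sum>k<n. S (u i k) * (if k = l then 1 else 0))"
    using l by (simp add: if_distrib[of "\<lambda>x. _ * x"] cong: if_cong)
  also have "\<dots> = (\<Sum>k<n. \<Sum>j<n. S (u i k) * u k j * star (u l j))"
    using l by (intro sum.cong) (simp_all add: corep_right[OF u, symmetric] sum_distrib_left mult.assoc)
  also have "\<dots> = (\<Sum>j<n. \<Sum>k<n. S (u i k) * u k j * star (u l j))"
    by (rule sum.swap)
  also have "\<dots> = (\<Sum>j<n. (if i = j then 1 else 0) * star (u l j))"
    using eq by (intro sum.cong) (simp_all flip: sum_distrib_right)
  also have "\<dots> = star (u l i)"
    using i by (simp add: if_distrib[of "\<lambda>x. x * _"] cong: if_cong)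
  finally show ?thesis .
qed

text \<open>The adjoint of a coefficient is a value of the antipode. This avoids the unitarization of the conjugate
  corepresentation.\<close>

lemma star_in_M: "a \<in> M \<Longrightarrow> star a \<in> M"
proof (induction rule: M_induct)
  case (coeff n u i j)
  then show ?case
    using S_in_M[OF coeff_in_M, of n u j i] by (simp add: S_coeff)
qed (simp_all add: star_add star_scaleC M_zero M_add M_scale)

lemma faithful_M:
  assumes "a \<in> M" "\<And>y. y \<in> M \<Longrightarrow> h (y * a) = 0"
  shows "a = 0"
  using assms star_in_M by (intro faithful_left) blast

lemma \<Delta>_star:
  assumes "\<Delta> a = (\<Sum>i\<in>I. \<tau> (x i) (y i))"
  shows "\<Delta> (star a) = (\<Sum>i\<in>I. \<tau> (star (x i)) (star (y i)))"
  by (simp add: \<Delta>_simps assms star_sum tensor.star)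

lemma sweedler_star_coeff:
  assumes u: "unitary_corep \<tau> \<Delta> n u" "i < n" "j < n" and B: "cbilinear_on M B"
  shows "sweedler \<tau> \<Delta> B (star (u i j)) = (\<Sum>k<n. B (star (u i k)) (star (u k j)))"
  using assms by (intro sweedler_eq) (auto simp: \<Delta>_star[OF corep_\<Delta>] coeff_in_M star_in_M)

lemma \<epsilon>_star:
  assumes "a \<in> M"
  shows "\<epsilon> (star a) = cnj (\<epsilon> a)"
  using assms
proof (induction rule: M_induct)
  case (coeff n u i l)
  have "cnj (\<epsilon> (star (u i l))) = (if i = l then 1 else 0)"
  proof (rule corep_row_eq_unit[OF coeff])
    fix j assume j: "j < n"
    have "(\<Sum>k<n. \<epsilon> (star (u i k)) *\<^sub>C star (u k j)) = star (u i j)"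
      using counit_left[OF star_in_M[OF coeff_in_M[OF coeff(1,2) j]]]
      by (subst (asm) sweedler_star_coeff[OF coeff(1,2) j])
        (auto intro: cbilinear_scaleC \<epsilon>_linear clinear_id)
    then have "star (\<Sum>k<n. \<epsilon> (star (u i k)) *\<^sub>C star (u k j)) = u i j"
      by (simp add: star_star)
    then show "(\<Sum>k<n. cnj (\<epsilon> (star (u i k))) *\<^sub>C u k j) = u i j"
      by (simp add: star_sum star_scaleC star_star)
  qed
  then have "cnj (cnj (\<epsilon> (star (u i l)))) = cnj (if i = l then 1 else 0)"
    by (rule arg_cong)
  then show ?case
    using coeff by (simp add: \<epsilon>_coeff)
next
  case zero
  then show ?case using clinear_on_zero[OF \<epsilon>_linear M_subspace] by simp
qed (simp_all add: star_add star_scaleC clinear_on_add[OF \<epsilon>_linear] clinear_on_scale[OF \<epsilon>_linear]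
  star_in_M M_scale)

text \<open>This involution identity makes the antipode injective.\<close>

lemma S_star_S_star: "a \<in> M \<Longrightarrow> star (S (star (S a))) = a"
proof (induction rule: M_induct)
  case (coeff n u i j)
  then show ?case by (simp add: S_coeff star_star)
next
  case zero
  then show ?case using clinear_on_zero[OF S_linear M_subspace] by simp
qed (simp_all add: star_add star_scaleC clinear_on_add[OF S_linear] clinear_on_scale[OF S_linear]
  star_in_M M_scale S_in_M)

lemma S_inj: "a \<in> M \<Longrightarrow> b \<in> M \<Longrightarrow> S a = S b \<Longrightarrow> a = b"
  using S_star_S_star by metis

text \<open>Since both sides are linear in \<open>b\<close>, let \<open>b\<close> be a matrix coefficient. Invariance for the products
  \<open>a u\<^bsub>km\<^esub>\<close> is then multiplied from the right by \<open>u\<^bsub>lm\<^esub>\<^sup>*\<close> and summed over \<open>m\<close>; unitarity removes the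
  second factor on one side and leaves the antipode on the other.\<close>

lemma strong_invariance:
  assumes a: "a \<in> M" and b: "b \<in> M"
  shows "sweedler \<tau> \<Delta> (\<lambda>x y. h (x * b) *\<^sub>C y) a = sweedler \<tau> \<Delta> (\<lambda>x y. h (a * x) *\<^sub>C S y) b"
proof -
  obtain I :: "'t set" and x y where I: "finite I" "\<And>i. i \<in> I \<Longrightarrow> x i \<in> M \<and> y i \<in> M"
      "\<Delta> a = (\<Sum>i\<in>I. \<tau> (x i) (y i))"
    using sweedler_family[OF a] by blast
  have lhs: "sweedler \<tau> \<Delta> (\<lambda>x y. h (x * b) *\<^sub>C y) a = (\<Sum>i\<in>I. h (x i * b) *\<^sub>C y i)" for b
    by (rule sweedler_eq[OF _ I]) (auto intro: cbilinear_scaleC h_mult_linear clinear_id)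
  have rhs_bil: "cbilinear_on M (\<lambda>x y. h (a * x) *\<^sub>C S y)"
    by (intro cbilinear_scaleC h_mult_linear S_linear)
  have lhs_linear: "clinear_on M (\<lambda>b. \<Sum>i\<in>I. h (x i * b) *\<^sub>C y i)"
    by (rule clinear_onI) (simp_all add: h_simps distrib_left mult_scaleC_right
        cvec.scale_left_distrib sum.distrib cvec.scale_sum_right)
  have "(\<Sum>i\<in>I. h (x i * b) *\<^sub>C y i) = sweedler \<tau> \<Delta> (\<lambda>x y. h (a * x) *\<^sub>C S y) b"
  proof (rule clinear_on_eq_cspan[of coeffs "\<lambda>b. \<Sum>i\<in>I. h (x i * b) *\<^sub>C y i"
        "sweedler \<tau> \<Delta> (\<lambda>x y. h (a * x) *\<^sub>C S y)"])
    fix b assume "b \<in> coeffs"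
    then obtain n u k l where u: "unitary_corep \<tau> \<Delta> n u" and k: "k < n" and l: "l < n" and b: "b = u k l"
      by (auto simp: coeffs_def)
    have inv: "(\<Sum>i\<in>I. \<Sum>r<n. h (x i * u k r) *\<^sub>C (y i * u r m)) = h (a * u k m) *\<^sub>C 1" if m: "m < n" for m
    proof -
      have "\<Delta> (a * u k m) = (\<Sum>(i, r)\<in>I \<times> {..<n}. \<tau> (x i * u k r) (y i * u r m))"
        using k m by (simp add: \<Delta>_simps I(3) corep_\<Delta>[OF u] sum_product tensor.mult sum.cartesian_product)
      then show ?thesis
        using haar_left_invariance[where a = "a * u k m" and K = "I \<times> {..<n}"
            and x = "\<lambda>(i, r). x i * u k r" and y = "\<lambda>(i, r). y i * u r m"]
        by (simp add: case_prod_unfold sum.cartesian_product)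
    qed
    have "sweedler \<tau> \<Delta> (\<lambda>x y. h (a * x) *\<^sub>C S y) b = (\<Sum>m<n. h (a * u k m) *\<^sub>C star (u l m))"
      unfolding b sweedler_coeff[OF u k l rhs_bil] using l by (intro sum.cong) (simp_all add: S_coeff[OF u])
    also have "\<dots> = (\<Sum>m<n. (h (a * u k m) *\<^sub>C 1) * star (u l m))"
      by (simp add: mult_scaleC_left)
    also have "\<dots> = (\<Sum>m<n. \<Sum>i\<in>I. \<Sum>r<n. h (x i * u k r) *\<^sub>C (y i * (u r m * star (u l m))))"
      by (intro sum.cong refl) (simp add: inv[symmetric] sum_distrib_right mult_scaleC_left mult.assoc)
    also have "\<dots> = (\<Sum>i\<in>I. \<Sum>r<n. \<Sum>m<n. h (x i * u k r) *\<^sub>C (y i * (u r m * star (u l m))))"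
      by (rule trans[OF sum.swap]) (rule sum.cong[OF refl], rule sum.swap)
    also have "\<dots> = (\<Sum>i\<in>I. \<Sum>r<n. h (x i * u k r) *\<^sub>C (y i * (\<Sum>m<n. u r m * star (u l m))))"
      by (simp add: sum_distrib_left cvec.scale_sum_right)
    also have "\<dots> = (\<Sum>i\<in>I. \<Sum>r<n. h (x i * u k r) *\<^sub>C (if r = l then y i else 0))"
      using l by (intro sum.cong refl) (simp add: corep_right[OF u])
    also have "\<dots> = (\<Sum>i\<in>I. h (x i * b) *\<^sub>C y i)"
      using l by (simp add: b if_distrib[of "\<lambda>x. _ *\<^sub>C x"] cong: if_cong)
    finally show "(\<Sum>i\<in>I. h (x i * b) *\<^sub>C y i) = sweedler \<tau> \<Delta> (\<lambda>x y. h (a * x) *\<^sub>C S y) b" ..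
  qed (use lhs_linear sweedler_linear[OF rhs_bil] b in \<open>simp_all add: M_eq[symmetric]\<close>)
  then show ?thesis
    by (simp add: lhs)
qed

section \<open>Coefficient spaces and the KMS automorphism\<close>

text \<open>Strong invariance for \<open>a = u\<^bsub>pq\<^esub>\<close> and \<open>b = u\<^bsub>pt\<^esub>\<^sup>*\<close> says that the matrix with entries
  \<open>h(u\<^bsub>pk\<^esub> u\<^bsub>pt\<^esub>\<^sup>*)\<close> intertwines \<open>u\<close> and \<open>S\<^sup>2(u)\<close>; summed over \<open>p\<close> it is positive definite because the
  Haar state is faithful, hence invertible. In place of the inverse, the proof takes a functional
  that vanishes on the coefficients of \<open>S\<^sup>2(u)\<close> and shows that it also vanishes on those of \<open>u\<close>.\<close>

lemma coeff_in_span_S2: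
  assumes u: "unitary_corep \<tau> \<Delta> n u" and r: "r < n" and q: "q < n"
  shows "u r q \<in> cspan {S (S (u i j)) |i j. i < n \<and> j < n}"
proof (rule ccontr)
  assume "u r q \<notin> cspan {S (S (u i j)) |i j. i < n \<and> j < n}"
  then obtain g :: "'a \<Rightarrow> complex" where g: "clinear_on UNIV g"
      "\<And>b. b \<in> {S (S (u i j)) |i j. i < n \<and> j < n} \<Longrightarrow> g b = 0" "g (u r q) = 1"
    using separating_functional by blast
  \<comment> \<open>The rows of \<open>u\<close> applied to the vector of values of \<open>g\<close> on column \<open>q\<close>; as \<open>u\<close> is invertible,
    it suffices to show that they vanish.\<close>
  define y where "y = (\<lambda>p. \<Sum>k<n. g (u k q) *\<^sub>C u p k)"
  have gram: "(\<Sum>k<n. h (u p k * star (u p t)) * g (u k q)) = 0" if p: "p < n" and t: "t < n" for p t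
  proof -
    have "(\<Sum>k<n. h (u p k * star (u p t)) *\<^sub>C u k q)
        = sweedler \<tau> \<Delta> (\<lambda>x y. h (x * star (u p t)) *\<^sub>C y) (u p q)"
      by (rule sweedler_coeff[OF u p q, symmetric]) (intro cbilinear_scaleC h_mult_linear clinear_id)
    also have "\<dots> = sweedler \<tau> \<Delta> (\<lambda>x y. h (u p q * x) *\<^sub>C S y) (star (u p t))"
      by (intro strong_invariance star_in_M coeff_in_M[OF u] p q t)
    also have "\<dots> = (\<Sum>w<n. h (u p q * star (u p w)) *\<^sub>C S (star (u w t)))"
      by (rule sweedler_star_coeff[OF u p t]) (intro cbilinear_scaleC h_mult_linear S_linear)
    also have "\<dots> = (\<Sum>w<n. h (u p q * star (u p w)) *\<^sub>C S (S (u t w)))"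
      using t by (intro sum.cong) (simp_all add: S_coeff[OF u])
    finally have "g (\<Sum>k<n. h (u p k * star (u p t)) *\<^sub>C u k q)
        = g (\<Sum>w<n. h (u p q * star (u p w)) *\<^sub>C S (S (u t w)))"
      by (rule arg_cong)
    moreover have "g (S (S (u t w))) = 0" if "w < n" for w
      using g(2) t that by blast
    ultimately show ?thesis
      by (simp add: clinear_on_lincomb[OF g(1)])
  qed
  have y0: "y p = 0" if p: "p < n" for p
  proof -
    have "h (y p * star (u p t)) = 0" if t: "t < n" for t
      using gram[OF p t]
      by (simp add: y_def sum_distrib_right mult_scaleC_left h_sum h_simps mult.commute)
    then have "h (star (star (y p)) * star (y p)) = 0"
      by (simp add: star_star) (subst (2) y_def,
          simp add: star_sum star_scaleC sum_distrib_left mult_scaleC_right h_sum h_simps)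
    then have "star (y p) = 0"
      by (rule faithful_left)
    then show ?thesis
      using star_star[of "y p"] by simp
  qed
  have "0 = (\<Sum>p<n. star (u p r) * y p)"
    using y0 by simp
  also have "\<dots> = (\<Sum>p<n. \<Sum>k<n. g (u k q) *\<^sub>C (star (u p r) * u p k))"
    by (simp add: y_def sum_distrib_left mult_scaleC_right)
  also have "\<dots> = (\<Sum>k<n. \<Sum>p<n. g (u k q) *\<^sub>C (star (u p r) * u p k))"
    by (rule sum.swap)
  also have "\<dots> = (\<Sum>k<n. g (u k q) *\<^sub>C (if r = k then 1 else 0))"
    using r by (intro sum.cong refl) (simp add: corep_left[OF u, symmetric] cvec.scale_sum_right)
  also have "\<dots> = g (u r q) *\<^sub>C 1"
    using r by (simp add: if_distrib[of "\<lambda>x. _ *\<^sub>C x"] cong: if_cong)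
  finally show False
    using g(3) by simp
qed

text \<open>Here \<open>S\<^sup>2\<close> is injective and, by the previous lemma, its image of the coefficient space contains the
  coefficient space.\<close>

lemma coeff_space_S2_closed:
  assumes u: "unitary_corep \<tau> \<Delta> n u" and w: "w \<in> M"
    and SSw: "S (S w) \<in> cspan {u i j |i j. i < n \<and> j < n}"
  shows "w \<in> cspan {u i j |i j. i < n \<and> j < n}"
proof -
  let ?C = "cspan {u i j |i j. i < n \<and> j < n}"
  have CM: "?C \<subseteq> M"
    using coeff_in_M[OF u] by (intro cvec.span_minimal M_subspace) auto
  have image: "\<exists>c\<in>?C. z = S (S c)" if "z \<in> cspan {S (S (u i j)) |i j. i < n \<and> j < n}" for z
    using that
  proof (induction rule: cvec.span_induct_alt)
    case base
    then show ?case
      using clinear_on_zero[OF S_linear M_subspace] by (intro bexI[of _ 0]) (simp_all add: cvec.span_zero)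
  next
    case (step k x y)
    then obtain i j c where ij: "i < n" "j < n" "x = S (S (u i j))" and c: "c \<in> ?C" "y = S (S c)"
      by blast
    have uC: "u i j \<in> ?C"
      using ij by (intro cvec.span_base) blast
    have "k *\<^sub>C x + y = S (S (k *\<^sub>C u i j + c))"
      using uC c CM by (simp add: ij clinear_on_add[OF S_linear] clinear_on_scale[OF S_linear] subset_iff S_in_M M_scale)
    then show ?case
      using uC c by (intro bexI[of _ "k *\<^sub>C u i j + c"]) (auto intro: cvec.span_add cvec.span_scale)
  qed
  have "?C \<subseteq> cspan {S (S (u i j)) |i j. i < n \<and> j < n}"
    using coeff_in_span_S2[OF u] by (intro cvec.span_minimal cvec.subspace_span) auto
  then obtain c where c: "c \<in> ?C" "S (S w) = S (S c)"
    using image SSw by blast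
  then have "w = c"
    using S_inj S_in_M w CM by blast
  with c show ?thesis by simp
qed

text \<open>Let \<open>b = T(u\<^bsub>pq\<^esub>)\<close>. Two applications of strong invariance, with the KMS condition in between, show that
  \<open>S\<^sup>2\<close> maps \<open>h(y b\<^sub>(\<^sub>1\<^sub>)) b\<^sub>(\<^sub>2\<^sub>)\<close> into the coefficient space, so all these slices of \<open>\<Delta> b\<close> lie in it.
  A functional \<open>g\<close> vanishing on the coefficient space therefore satisfies \<open>h(y b\<^sub>(\<^sub>1\<^sub>)) g(b\<^sub>(\<^sub>2\<^sub>)) = 0\<close> for all
  \<open>y\<close>. Faithfulness gives \<open>b\<^sub>(\<^sub>1\<^sub>) g(b\<^sub>(\<^sub>2\<^sub>)) = 0\<close>, and the counit gives \<open>g(b) = 0\<close>.\<close>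

lemma kms_preserves_coeff_space:
  assumes u: "unitary_corep \<tau> \<Delta> n u" and p: "p < n" and q: "q < n"
    and TM: "\<And>a. a \<in> M \<Longrightarrow> T a \<in> M" and kms: "\<And>a b. a \<in> M \<Longrightarrow> b \<in> M \<Longrightarrow> h (a * b) = h (b * T a)"
  shows "T (u p q) \<in> cspan {u i j |i j. i < n \<and> j < n}"
proof (rule ccontr)
  let ?C = "cspan {u i j |i j. i < n \<and> j < n}"
  define b where "b = T (u p q)"
  have upq: "u p q \<in> M"
    by (rule coeff_in_M[OF u p q])
  then have b: "b \<in> M"
    by (simp add: b_def TM)
  assume "T (u p q) \<notin> ?C"
  then obtain g :: "'a \<Rightarrow> complex" where g: "clinear_on UNIV g"
      "\<And>x. x \<in> {u i j |i j. i < n \<and> j < n} \<Longrightarrow> g x = 0" "g b = 1"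
    using separating_functional unfolding b_def by blast
  have gC: "g x = 0" if "x \<in> ?C" for x
    using clinear_on_eq_cspan[where g = "\<lambda>_. 0", OF clinear_on_subset[OF g(1)] _ g(2) that]
    by (simp add: clinear_on_def)
  have gM: "clinear_on M g"
    by (rule clinear_on_subset[OF g(1)]) simp
  have slice: "sweedler \<tau> \<Delta> (\<lambda>x z. h (y * x) *\<^sub>C z) b \<in> ?C" if y: "y \<in> M" for y
  proof (rule coeff_space_S2_closed[OF u])
    show "sweedler \<tau> \<Delta> (\<lambda>x z. h (y * x) *\<^sub>C z) b \<in> M" (is "?w \<in> M")
      by (rule sweedler_mem) (auto intro: cbilinear_scaleC h_mult_linear clinear_id M_scale M_subspace b)
    have "S ?w = sweedler \<tau> \<Delta> (\<lambda>x z. S (h (y * x) *\<^sub>C z)) b"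
      by (rule sweedler_comp[OF _ S_linear M_subspace _ b])
        (auto intro: cbilinear_scaleC h_mult_linear clinear_id M_scale)
    also have "\<dots> = sweedler \<tau> \<Delta> (\<lambda>x z. h (y * x) *\<^sub>C S z) b"
      by (rule sweedler_cong) (simp add: clinear_on_scale[OF S_linear])
    also have "\<dots> = sweedler \<tau> \<Delta> (\<lambda>x z. h (x * b) *\<^sub>C z) y"
      by (rule strong_invariance[symmetric, OF y b])
    also have "\<dots> = sweedler \<tau> \<Delta> (\<lambda>x z. h (u p q * x) *\<^sub>C z) y"
      by (rule sweedler_cong) (simp add: b_def kms[OF upq])
    finally have "S (S ?w) = S (sweedler \<tau> \<Delta> (\<lambda>x z. h (u p q * x) *\<^sub>C z) y)"
      by (rule arg_cong)
    also have "\<dots> = sweedler \<tau> \<Delta> (\<lambda>x z. S (h (u p q * x) *\<^sub>C z)) y"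
      by (rule sweedler_comp[OF _ S_linear M_subspace _ y])
        (auto intro: cbilinear_scaleC h_mult_linear clinear_id M_scale)
    also have "\<dots> = sweedler \<tau> \<Delta> (\<lambda>x z. h (u p q * x) *\<^sub>C S z) y"
      by (rule sweedler_cong) (simp add: clinear_on_scale[OF S_linear])
    also have "\<dots> = sweedler \<tau> \<Delta> (\<lambda>x z. h (x * y) *\<^sub>C z) (u p q)"
      by (rule strong_invariance[symmetric, OF upq y])
    also have "\<dots> = (\<Sum>k<n. h (u p k * y) *\<^sub>C u k q)"
      by (rule sweedler_coeff[OF u p q]) (intro cbilinear_scaleC h_mult_linear clinear_id)
    also have "\<dots> \<in> ?C"
      using q by (intro cvec.span_sum cvec.span_scale cvec.span_base) auto
    finally show "S (S ?w) \<in> ?C" .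
  qed
  define v where "v = sweedler \<tau> \<Delta> (\<lambda>x z. g z *\<^sub>C x) b"
  have bil: "cbilinear_on M (\<lambda>x z. g z *\<^sub>C x)"
    by (intro cbilinear_scaleC gM clinear_id)
  have vM: "v \<in> M"
    unfolding v_def by (rule sweedler_mem[OF bil]) (auto intro: M_scale M_subspace b)
  have "h (y * v) = 0" if y: "y \<in> M" for y
  proof -
    have "h (y * v) = sweedler \<tau> \<Delta> (\<lambda>x z. h (y * (g z *\<^sub>C x))) b"
      unfolding v_def
      by (rule sweedler_comp[OF bil h_mult_linear(2)[of M y] M_subspace _ b]) (rule M_scale)
    also have "\<dots> = sweedler \<tau> \<Delta> (\<lambda>x z. g (h (y * x) *\<^sub>C z)) b"
      by (rule sweedler_cong)
        (simp add: clinear_on_scale[OF g(1)] mult_scaleC_right h_simps mult.commute)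
    also have "\<dots> = g (sweedler \<tau> \<Delta> (\<lambda>x z. h (y * x) *\<^sub>C z) b)"
      by (rule sweedler_comp[OF _ gM M_subspace _ b, symmetric])
        (auto intro: cbilinear_scaleC h_mult_linear clinear_id M_scale)
    also have "\<dots> = 0"
      by (rule gC[OF slice[OF y]])
    finally show ?thesis .
  qed
  then have "v = 0"
    using vM by (intro faithful_M) auto
  have "1 = g (sweedler \<tau> \<Delta> (\<lambda>x z. \<epsilon> x *\<^sub>C z) b)"
    by (simp add: counit_left b g(3))
  also have "\<dots> = sweedler \<tau> \<Delta> (\<lambda>x z. g (\<epsilon> x *\<^sub>C z)) b"
    by (rule sweedler_comp[OF _ gM M_subspace _ b])
      (auto intro: cbilinear_scaleC \<epsilon>_linear clinear_id M_scale)
  also have "\<dots> = sweedler \<tau> \<Delta> (\<lambda>x z. \<epsilon> (g z *\<^sub>C x)) b"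
    by (rule sweedler_cong)
      (simp add: clinear_on_scale[OF g(1)] clinear_on_scale[OF \<epsilon>_linear] mult.commute)
  also have "\<dots> = \<epsilon> v"
    unfolding v_def by (rule sweedler_comp[OF bil \<epsilon>_linear M_subspace _ b, symmetric]) (rule M_scale)
  finally show False
    using clinear_on_zero[OF \<epsilon>_linear M_subspace] \<open>v = 0\<close> by simp
qed

end

section \<open>The generator\<close>

locale cqg_schuermann = cqg_hopf \<tau> \<Delta> \<epsilon> h S
  for \<tau> :: "'a::cstar_algebra \<Rightarrow> 'a \<Rightarrow> 't::cstar_algebra" and \<Delta> \<epsilon> h S +
  fixes \<phi> :: "'a \<Rightarrow> complex"
    and \<sigma> :: "complex \<Rightarrow> 'a \<Rightarrow> 'a"
    and \<rho> :: "'a \<Rightarrow> 'h::chilbert_space \<Rightarrow> 'h"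
    and \<xi> :: 'h
    and \<pi> :: "'a \<Rightarrow> 'k::chilbert_space \<Rightarrow> 'k"
    and \<eta> :: "'a \<Rightarrow> 'k"
    and \<theta> :: "'h \<Rightarrow> 'k \<Rightarrow> 'g::chilbert_space"
  assumes gns: "gns_triple h \<rho> \<xi>"
    and modular: "is_modular_group M h \<sigma>"
    and generating: "generating_functional M \<epsilon> \<phi>"
    and symmetric: "gns_symmetric M S \<phi>"
    and schuermann: "schuermann_triple M \<epsilon> \<pi> \<eta> \<phi>"
    and tensor_hilbert: "hilbert_tensor \<theta>"
begin

lemma \<phi>_linear: "clinear_on M \<phi>" and \<phi>_star: "a \<in> M \<Longrightarrow> \<phi> (star a) = cnj (\<phi> a)" and \<phi>_one: "\<phi> 1 = 0"
  using generating by (simp_all add: generating_functional_def)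

lemma \<phi>_S: "a \<in> M \<Longrightarrow> \<phi> (S a) = \<phi> a"
  using symmetric by (simp add: gns_symmetric_def)

abbreviation L :: "'a \<Rightarrow> 'a" where "L \<equiv> conv_operator \<tau> \<Delta> \<phi>"

lemma L_bilinear: "cbilinear_on M (\<lambda>x y. \<phi> y *\<^sub>C x)"
  by (intro cbilinear_scaleC \<phi>_linear clinear_id)

lemma L_linear: "clinear_on M L"
  unfolding conv_operator_def by (rule sweedler_linear[OF L_bilinear])

lemma L_in_M: "a \<in> M \<Longrightarrow> L a \<in> M"
  unfolding conv_operator_def by (rule sweedler_mem[OF L_bilinear]) (auto intro: M_scale M_subspace)

lemma L_star:
  assumes "a \<in> M"
  shows "L (star a) = star (L a)"
proof -
  obtain I :: "'t set" and x y where I: "finite I" "\<And>i. i \<in> I \<Longrightarrow> x i \<in> M \<and> y i \<in> M"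
      "\<Delta> a = (\<Sum>i\<in>I. \<tau> (x i) (y i))"
    using sweedler_family[OF assms] by blast
  have "L (star a) = (\<Sum>i\<in>I. \<phi> (star (y i)) *\<^sub>C star (x i))"
    unfolding conv_operator_def using I(2)
    by (intro sweedler_eq[OF L_bilinear I(1) _ \<Delta>_star[OF I(3)]]) (auto intro: star_in_M)
  also have "\<dots> = star (\<Sum>i\<in>I. \<phi> (y i) *\<^sub>C x i)"
    using I(2) by (simp add: star_sum star_scaleC \<phi>_star)
  also have "\<dots> = star (L a)"
    unfolding conv_operator_def by (rule arg_cong[OF sweedler_eq[OF L_bilinear I, symmetric]])
  finally show ?thesis .
qed

text \<open>Apply \<open>\<phi>\<close> to both sides of strong invariance; GNS-symmetry removes the antipode.\<close>

lemma L_symmetric: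
  assumes a: "a \<in> M" and b: "b \<in> M"
  shows "h (L a * b) = h (a * L b)"
proof -
  have "h (L a * b) = sweedler \<tau> \<Delta> (\<lambda>x y. h ((\<phi> y *\<^sub>C x) * b)) a"
    unfolding conv_operator_def
    by (rule sweedler_comp[OF L_bilinear h_mult_linear(1)[of M b] M_subspace _ a]) (rule M_scale)
  also have "\<dots> = sweedler \<tau> \<Delta> (\<lambda>x y. \<phi> (h (x * b) *\<^sub>C y)) a"
    by (rule sweedler_cong)
      (simp add: clinear_on_scale[OF \<phi>_linear] mult_scaleC_left h_simps mult.commute)
  also have "\<dots> = \<phi> (sweedler \<tau> \<Delta> (\<lambda>x y. h (x * b) *\<^sub>C y) a)"
    by (rule sweedler_comp[OF _ \<phi>_linear M_subspace _ a, symmetric])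
      (auto intro: cbilinear_scaleC h_mult_linear clinear_id M_scale)
  also have "\<dots> = \<phi> (sweedler \<tau> \<Delta> (\<lambda>x y. h (a * x) *\<^sub>C S y) b)"
    by (simp add: strong_invariance a b)
  also have "\<dots> = sweedler \<tau> \<Delta> (\<lambda>x y. \<phi> (h (a * x) *\<^sub>C S y)) b"
    by (rule sweedler_comp[OF _ \<phi>_linear M_subspace _ b])
      (auto intro: cbilinear_scaleC h_mult_linear S_linear M_scale S_in_M)
  also have "\<dots> = sweedler \<tau> \<Delta> (\<lambda>x y. h (a * (\<phi> y *\<^sub>C x))) b"
    by (rule sweedler_cong)
      (simp add: clinear_on_scale[OF \<phi>_linear] S_in_M \<phi>_S mult_scaleC_right h_simps mult.commute)
  also have "\<dots> = h (a * L b)"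
    unfolding conv_operator_def
    by (rule sweedler_comp[OF L_bilinear h_mult_linear(2)[of M a] M_subspace _ b, symmetric]) (rule M_scale)
  finally show ?thesis .
qed

section \<open>The modular group\<close>

lemma \<sigma>_in_M: "a \<in> M \<Longrightarrow> \<sigma> z a \<in> M"
  using modular unfolding is_modular_group_def by blast

lemma \<sigma>_linear: "clinear_on M (\<sigma> z)"
  and \<sigma>_mult: "a \<in> M \<Longrightarrow> b \<in> M \<Longrightarrow> \<sigma> z (a * b) = \<sigma> z a * \<sigma> z b"
  and \<sigma>_0: "a \<in> M \<Longrightarrow> \<sigma> 0 a = a"
  and \<sigma>_\<sigma>: "a \<in> M \<Longrightarrow> \<sigma> z (\<sigma> w a) = \<sigma> (z + w) a"
  and \<sigma>_star: "a \<in> M \<Longrightarrow> star (\<sigma> z a) = \<sigma> (cnj z) (star a)"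
  and h_\<sigma>: "a \<in> M \<Longrightarrow> h (\<sigma> z a) = h a"
  and kms: "a \<in> M \<Longrightarrow> b \<in> M \<Longrightarrow> h (a * b) = h (b * \<sigma> (- \<i>) a)"
  using modular by (auto simp: is_modular_group_def)

text \<open>The hypothesis on \<open>z\<close> says that it is purely imaginary. There \<open>\<sigma>\<close> is symmetric and, by the next lemma,
  positive for the inner product \<open>h(a\<^sup>* b)\<close>.\<close>

lemma \<sigma>_symmetric:
  assumes a: "a \<in> M" and b: "b \<in> M" and z: "cnj z = - z"
  shows "h (star (\<sigma> z a) * b) = h (star a * \<sigma> z b)"
proof -
  have "h (star (\<sigma> z a) * b) = h (\<sigma> z (\<sigma> (- z) (star a) * b))"
    using a b z by (simp add: \<sigma>_star h_\<sigma> \<sigma>_in_M star_in_M M_mult)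
  then show ?thesis
    using a b by (simp add: \<sigma>_mult \<sigma>_in_M star_in_M \<sigma>_\<sigma> \<sigma>_0)
qed

lemma \<sigma>_positive:
  assumes a: "a \<in> M" and z: "cnj z = - z"
  shows "h (star a * \<sigma> (z + z) a) = h (star (\<sigma> z a) * \<sigma> z a)"
  using \<sigma>_symmetric[OF a \<sigma>_in_M[OF a] z, of z] a by (simp add: \<sigma>_\<sigma>)

lemma \<sigma>_eq_0: "a \<in> M \<Longrightarrow> \<sigma> z a = 0 \<Longrightarrow> a = 0"
  using \<sigma>_\<sigma>[of a "- z" z] \<sigma>_0[of a] clinear_on_zero[OF \<sigma>_linear M_subspace] by simp

text \<open>Otherwise the difference \<open>y\<close> would be an eigenvector of \<open>\<sigma> z\<close> with eigenvalue \<open>- sqrt r \<le> 0\<close>, although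
  \<open>\<sigma> z\<close> is the square of the injective symmetric operator \<open>\<sigma> (z / 2)\<close>.\<close>

lemma \<sigma>_sqrt_eigenvector:
  assumes e: "e \<in> M" and z: "cnj z = - z" and r: "r \<ge> 0"
    and eq: "\<sigma> (z + z) e = complex_of_real r *\<^sub>C e"
  shows "\<sigma> z e = complex_of_real (sqrt r) *\<^sub>C e"
proof -
  define y where "y = \<sigma> z e - complex_of_real (sqrt r) *\<^sub>C e"
  have y: "y \<in> M"
    using e by (simp add: y_def M_diff M_scale \<sigma>_in_M)
  have eq': "\<sigma> z (\<sigma> z e) = complex_of_real r *\<^sub>C e"
    using \<sigma>_\<sigma>[OF e] eq by simp
  have "\<sigma> z y = complex_of_real r *\<^sub>C e - complex_of_real (sqrt r) *\<^sub>C \<sigma> z e"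
    using e by (simp add: y_def clinear_on_diff[OF \<sigma>_linear M_subspace] clinear_on_scale[OF \<sigma>_linear]
        \<sigma>_in_M M_scale eq')
  also have "complex_of_real r = complex_of_real (sqrt r) * complex_of_real (sqrt r)"
    using r by (simp flip: of_real_mult)
  finally have "\<sigma> z y = (- complex_of_real (sqrt r)) *\<^sub>C y"
    by (simp add: y_def cvec.scale_right_diff_distrib)
  then have *: "h (star y * \<sigma> z y) = - complex_of_real (sqrt r) * h (star y * y)"
    by (simp add: mult_scaleC_right h_simps)
  have "cnj (z / 2) = - (z / 2)"
    using z by simp
  then have "h (star y * \<sigma> z y) = h (star (\<sigma> (z / 2) y) * \<sigma> (z / 2) y)"
    using \<sigma>_positive[OF y, of "z / 2"] by simp
  then obtain s t where "s \<ge> 0" "t \<ge> 0" "h (star (\<sigma> (z / 2) y) * \<sigma> (z / 2) y) = complex_of_real s"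
      "complex_of_real s = - complex_of_real (sqrt r) * complex_of_real t"
    using h_pos[of y] h_pos[of "\<sigma> (z / 2) y"] * by metis
  moreover from this have "s = - sqrt r * t"
    by (simp flip: of_real_mult of_real_minus)
  moreover have "sqrt r * t \<ge> 0"
    using r \<open>t \<ge> 0\<close> by simp
  ultimately have "h (star (\<sigma> (z / 2) y) * \<sigma> (z / 2) y) = 0"
    by simp
  then have "y = 0"
    using \<sigma>_eq_0[OF y] faithful_left by blast
  then show ?thesis
    by (simp add: y_def)
qed

text \<open>A symmetric operator has real eigenvalues \<open>\<mu>\<close>, and the range of \<open>T - \<mu>\<close> is orthogonal to its kernel.\<close>

lemma kms_semisimple:
  assumes x: "x \<in> M" and eq: "\<sigma> (- \<i>) (\<sigma> (- \<i>) x - \<mu> *\<^sub>C x) = \<mu> *\<^sub>C (\<sigma> (- \<i>) x - \<mu> *\<^sub>C x)"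
  shows "\<sigma> (- \<i>) x = \<mu> *\<^sub>C x"
proof (rule ccontr)
  define y where "y = \<sigma> (- \<i>) x - \<mu> *\<^sub>C x"
  assume "\<sigma> (- \<i>) x \<noteq> \<mu> *\<^sub>C x"
  then have y0: "h (star y * y) \<noteq> 0"
    using faithful_left[of y] by (auto simp: y_def)
  have y: "y \<in> M"
    using x by (simp add: y_def M_diff M_scale \<sigma>_in_M)
  have Ty: "\<sigma> (- \<i>) y = \<mu> *\<^sub>C y"
    using eq by (simp add: y_def)
  have "cnj \<mu> * h (star y * y) = \<mu> * h (star y * y)"
    using \<sigma>_symmetric[OF y y, of "- \<i>"] by (simp add: Ty star_scaleC mult_scaleC_left mult_scaleC_right h_simps)
  then have \<mu>: "cnj \<mu> = \<mu>"
    using y0 by simp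
  have "h (star y * y) = h (star y * \<sigma> (- \<i>) x) - \<mu> * h (star y * x)"
    by (subst (2) y_def) (simp add: right_diff_distrib mult_scaleC_right h_simps)
  also have "h (star y * \<sigma> (- \<i>) x) = \<mu> * h (star y * x)"
    using \<sigma>_symmetric[OF y x, of "- \<i>"] \<mu> by (simp add: Ty star_scaleC mult_scaleC_left h_simps)
  finally show False
    using y0 by simp
qed

text \<open>Every generator lies in the coefficient space of its corepresentation, which is spanned by finitely many
  elements and invariant.\<close>

lemma M_eigenspan: "M = eigenspan M (\<sigma> (- \<i>))"
proof
  note es = M_subspace \<sigma>_linear[of "- \<i>"] \<sigma>_in_M[of _ "- \<i>"] kms_semisimple
  show "eigenspan M (\<sigma> (- \<i>)) \<subseteq> M"
    by (rule eigenspan_subset[OF es])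
  have "u i j \<in> eigenspan M (\<sigma> (- \<i>))" if u: "unitary_corep \<tau> \<Delta> n u" and ij: "i < n" "j < n" for n u i j
  proof (rule finite_invariant_imp_eigenspan[OF es])
    let ?G = "{u i j |i j. i < n \<and> j < n}"
    have "?G = (\<lambda>(i, j). u i j) ` ({..<n} \<times> {..<n})"
      by auto
    then show "finite ?G"
      by simp
    show GM: "cspan ?G \<subseteq> M"
      using coeff_in_M[OF u] by (intro cvec.span_minimal M_subspace) auto
    have "\<sigma> (- \<i>) b \<in> cspan ?G" if "b \<in> ?G" for b
      using that kms_preserves_coeff_space[OF u _ _ \<sigma>_in_M kms] by blast
    then show "\<sigma> (- \<i>) x \<in> cspan ?G" if "x \<in> cspan ?G" for x
      using clinear_on_image_cspan[OF clinear_on_subset[OF \<sigma>_linear GM] _ cvec.subspace_span that] by blast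
    show "u i j \<in> cspan ?G"
      using ij by (intro cvec.span_base) blast
  qed
  then show "M \<subseteq> eigenspan M (\<sigma> (- \<i>))"
    unfolding M_eq eigenspan_def by (intro cvec.span_minimal cvec.subspace_span) (auto simp: coeffs_def M_eq)
qed

text \<open>Both \<open>L\<close> and the KMS automorphism can be moved across the Haar state, so
  \<open>h(y L(\<sigma>\<^bsub>-i\<^esub> a)) = h(L(y) \<sigma>\<^bsub>-i\<^esub> a) = h(a L(y)) = h(L(a) y) = h(y \<sigma>\<^bsub>-i\<^esub>(L a))\<close>.\<close>

lemma L_kms_commute:
  assumes a: "a \<in> M"
  shows "L (\<sigma> (- \<i>) a) = \<sigma> (- \<i>) (L a)"
proof -
  let ?d = "L (\<sigma> (- \<i>) a) - \<sigma> (- \<i>) (L a)"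
  have d: "?d \<in> M"
    using a by (simp add: M_diff L_in_M \<sigma>_in_M)
  have "h (y * ?d) = 0" if y: "y \<in> M" for y
  proof -
    have "h (y * L (\<sigma> (- \<i>) a)) = h (L y * \<sigma> (- \<i>) a)"
      using a y by (simp add: L_symmetric \<sigma>_in_M)
    also have "\<dots> = h (a * L y)"
      using a y by (simp add: kms[of a] L_in_M)
    also have "\<dots> = h (L a * y)"
      using a y by (simp add: L_symmetric)
    also have "\<dots> = h (y * \<sigma> (- \<i>) (L a))"
      using a y by (simp add: kms L_in_M)
    finally show ?thesis
      by (simp add: right_diff_distrib h_simps)
  qed
  then have "?d = 0"
    using d by (intro faithful_M) auto
  then show ?thesis by simp
qed

text \<open>The scalar depends on the eigenvalue only; it is therefore the same for an eigenvector \<open>e\<close> and for \<open>L e\<close>.\<close>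

lemma quarter_root_of_eigenvalue:
  obtains c where "\<And>e'. e' \<in> M \<Longrightarrow> \<sigma> (- \<i>) e' = \<mu> *\<^sub>C e' \<Longrightarrow> \<sigma> (- \<i> / 4) e' = c *\<^sub>C e'"
proof (cases "\<exists>e\<in>M. e \<noteq> 0 \<and> \<sigma> (- \<i>) e = \<mu> *\<^sub>C e")
  case False
  then show ?thesis
    using clinear_on_zero[OF \<sigma>_linear M_subspace] by (intro that[of 0]) fastforce
next
  case True
  then obtain e where e: "e \<in> M" "e \<noteq> 0" "\<sigma> (- \<i>) e = \<mu> *\<^sub>C e"
    by blast
  obtain s where s: "s \<ge> 0" "h (star e * e) = complex_of_real s"
    using h_pos by blast
  have s0: "s > 0"
    using s e(2) faithful_left[of e] by (cases "s = 0") auto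
  have "\<mu> * h (star e * e) = h (star (\<sigma> (- \<i> / 2) e) * \<sigma> (- \<i> / 2) e)"
    using \<sigma>_positive[OF e(1), of "- \<i> / 2"] e(3) by (simp add: mult_scaleC_right h_simps)
  then obtain t where t: "t \<ge> 0" "\<mu> * complex_of_real s = complex_of_real t"
    using h_pos s by metis
  define r where "r = t / s"
  have r: "r \<ge> 0" "\<mu> = complex_of_real r"
    using t s0 by (simp_all add: r_def field_simps)
  show ?thesis
  proof (rule that[of "complex_of_real (sqrt (sqrt r))"])
    fix e' assume e': "e' \<in> M" "\<sigma> (- \<i>) e' = \<mu> *\<^sub>C e'"
    then have "\<sigma> (- \<i> / 2) e' = complex_of_real (sqrt r) *\<^sub>C e'"
      using r by (intro \<sigma>_sqrt_eigenvector) auto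
    then show "\<sigma> (- \<i> / 4) e' = complex_of_real (sqrt (sqrt r)) *\<^sub>C e'"
      using e' r by (intro \<sigma>_sqrt_eigenvector) auto
  qed
qed

lemma L_\<sigma>_commute:
  assumes a: "a \<in> M"
  shows "L (\<sigma> (- \<i> / 4) a) = \<sigma> (- \<i> / 4) (L a)"
proof -
  let ?E = "{e\<in>M. \<exists>\<mu>. \<sigma> (- \<i>) e = \<mu> *\<^sub>C e}"
  have span: "cspan ?E = M"
    using M_eigenspan by (simp add: eigenspan_def)
  show ?thesis
  proof (rule clinear_on_eq_cspan[of ?E "\<lambda>a. L (\<sigma> (- \<i> / 4) a)" "\<lambda>a. \<sigma> (- \<i> / 4) (L a)"])
    fix e assume "e \<in> ?E"
    then obtain \<mu> where e: "e \<in> M" "\<sigma> (- \<i>) e = \<mu> *\<^sub>C e" by blast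
    obtain c where c: "\<And>e'. e' \<in> M \<Longrightarrow> \<sigma> (- \<i>) e' = \<mu> *\<^sub>C e' \<Longrightarrow> \<sigma> (- \<i> / 4) e' = c *\<^sub>C e'"
      using quarter_root_of_eigenvalue by blast
    have "\<sigma> (- \<i>) (L e) = \<mu> *\<^sub>C L e"
      using e by (simp flip: L_kms_commute add: clinear_on_scale[OF L_linear])
    then show "L (\<sigma> (- \<i> / 4) e) = \<sigma> (- \<i> / 4) (L e)"
      using c[OF e] c[OF L_in_M[OF e(1)]] by (simp add: clinear_on_scale[OF L_linear e(1)])
  qed (use a in \<open>auto simp: span clinear_on_def clinear_on_add[OF L_linear] clinear_on_scale[OF L_linear]
      clinear_on_add[OF \<sigma>_linear] clinear_on_scale[OF \<sigma>_linear] L_in_M \<sigma>_in_M\<close>)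
qed

section \<open>The derivation\<close>

abbreviation g :: "'a \<Rightarrow> 'h" where "g \<equiv> gns_map \<rho> \<xi>"
abbreviation del :: "'a \<Rightarrow> 'g" where "del \<equiv> derivation \<tau> \<Delta> \<theta> \<rho> \<xi> \<eta>"

lemma g_linear: "clinear_on N g"
  using gns by (auto simp: gns_triple_def star_rep_def gns_map_def clinear_on_def)

lemma g_inner: "cinner (g a) (g b) = h (star a * b)"
proof -
  have "cinner (\<rho> (star (star a)) \<xi>) (\<rho> b \<xi>) = cinner \<xi> (\<rho> (star a) (\<rho> b \<xi>))"
    using gns unfolding gns_triple_def star_rep_def by blast
  then show ?thesis
    using gns by (simp add: gns_triple_def star_rep_def gns_map_def star_star)
qed

lemma g_inj: "inj_on g N"
proof (rule inj_onI)
  fix a b assume "g a = g b"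
  then have "g (a - b) = 0"
    using clinear_on_diff[OF g_linear[of UNIV], of a b] by simp
  then have "h (star (a - b) * (a - b)) = 0"
    using g_inner[of "a - b" "a - b"] by simp
  then show "a = b"
    using faithful_left[of "a - b"] by simp
qed

lemma \<eta>_linear: "clinear_on M \<eta>"
  and \<eta>_mult: "a \<in> M \<Longrightarrow> b \<in> M \<Longrightarrow> \<eta> (a * b) = \<pi> a (\<eta> b) + \<epsilon> b *\<^sub>C \<eta> a"
  and \<eta>_inner_ker: "a \<in> M \<Longrightarrow> b \<in> M \<Longrightarrow> \<epsilon> a = 0 \<Longrightarrow> \<epsilon> b = 0 \<Longrightarrow> \<phi> (a * b) = cinner (\<eta> (star a)) (\<eta> b)"
  and \<pi>_one: "\<pi> 1 v = v"
  using schuermann by (auto simp: schuermann_triple_def star_rep_def)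

lemma \<eta>_one: "\<eta> 1 = 0"
  using \<eta>_mult[OF one_in_M one_in_M] by (simp add: \<epsilon>_one \<pi>_one)

text \<open>Replace \<open>a\<close> and \<open>b\<close> by \<open>a - \<epsilon>(a) 1\<close> and \<open>b - \<epsilon>(b) 1\<close>, which lie in the kernel of the counit and have the
  same image under \<open>\<eta>\<close>.\<close>

lemma \<eta>_inner:
  assumes a: "a \<in> M" and b: "b \<in> M"
  shows "cinner (\<eta> a) (\<eta> b) = \<phi> (star a * b) - cnj (\<epsilon> a) * \<phi> b - \<epsilon> b * cnj (\<phi> a)"
proof -
  define k where "k = (\<lambda>a. a - \<epsilon> a *\<^sub>C 1)"
  have k: "k a \<in> M" "\<epsilon> (k a) = 0" "\<eta> (k a) = \<eta> a" if "a \<in> M" for a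
    using that by (simp_all add: k_def M_diff M_scale one_in_M clinear_on_diff[OF \<epsilon>_linear M_subspace]
        clinear_on_scale[OF \<epsilon>_linear] \<epsilon>_one clinear_on_diff[OF \<eta>_linear M_subspace]
        clinear_on_scale[OF \<eta>_linear] \<eta>_one)
  have "cinner (\<eta> a) (\<eta> b) = \<phi> (star (k a) * k b)"
    using \<eta>_inner_ker[of "star (k a)" "k b"] k a b by (simp add: star_in_M \<epsilon>_star star_star)
  also have "star (k a) * k b
      = star a * b - cnj (\<epsilon> a) *\<^sub>C b - \<epsilon> b *\<^sub>C star a + (cnj (\<epsilon> a) * \<epsilon> b) *\<^sub>C 1"
    by (simp add: k_def star_diff star_scaleC algebra_simps mult_scaleC_left mult_scaleC_right)
  also have "\<phi> \<dots> = \<phi> (star a * b) - cnj (\<epsilon> a) * \<phi> b - \<epsilon> b * cnj (\<phi> a)"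
    using a b by (simp add: clinear_on_diff[OF \<phi>_linear M_subspace] clinear_on_scale[OF \<phi>_linear]
        clinear_on_add[OF \<phi>_linear] \<phi>_one \<phi>_star M_diff M_scale M_add M_mult one_in_M star_in_M)
  finally show ?thesis .
qed

lemma \<theta>_inner: "cinner (\<theta> v w) (\<theta> v' w') = cinner v v' * cinner w w'"
  using tensor_hilbert by (simp add: hilbert_tensor_def)

lemma derivation_bilinear: "cbilinear_on M (\<lambda>x y. \<theta> (g x) (\<eta> y))"
proof -
  have "clinear_on UNIV (\<theta> v)" "clinear_on UNIV (\<lambda>v. \<theta> v w)" for v w
    using tensor_hilbert by (simp_all add: hilbert_tensor_def cbilinear_def)
  then show ?thesis
    using \<eta>_linear g_linear[of M] unfolding cbilinear_on_def clinear_on_def by simp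
qed

lemma derivation_linear: "clinear_on M del"
  unfolding derivation_def by (rule sweedler_linear[OF derivation_bilinear])

lemma h_star_sum_mult_sum:
  "h (star (\<Sum>i\<in>I. c i *\<^sub>C x i) * (\<Sum>j\<in>J. d j *\<^sub>C x' j))
    = (\<Sum>i\<in>I. \<Sum>j\<in>J. h (star (x i) * x' j) * (cnj (c i) * d j))"
  by (simp add: star_sum star_scaleC sum_product h_sum mult_scaleC_left mult_scaleC_right h_simps
      algebra_simps)

text \<open>With decompositions of \<open>\<Delta> a\<close> and \<open>\<Delta> b\<close>, the formula for \<open>\<langle>\<eta>(x), \<eta>(y)\<rangle>\<close> gives three double sums. The first
  is \<open>(h \<otimes> \<phi>)(\<Delta>(a\<^sup>* b))\<close>; in each of the others the second legs of one argument
  are contracted with the counit and those of the other argument with \<open>\<phi>\<close>.\<close>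

lemma derivation_inner:
  assumes a: "a \<in> M" and b: "b \<in> M"
  shows "cinner (del a) (del b) = - 2 * h (star a * L b)"
proof -
  obtain I :: "'t set" and x y where I: "finite I" "\<And>i. i \<in> I \<Longrightarrow> x i \<in> M \<and> y i \<in> M"
      "\<Delta> a = (\<Sum>i\<in>I. \<tau> (x i) (y i))"
    using sweedler_family[OF a] by blast
  obtain J :: "'t set" and x' y' where J: "finite J" "\<And>i. i \<in> J \<Longrightarrow> x' i \<in> M \<and> y' i \<in> M"
      "\<Delta> b = (\<Sum>i\<in>J. \<tau> (x' i) (y' i))"
    using sweedler_family[OF b] by blast
  let ?h = "\<lambda>i j. h (star (x i) * x' j)"
  have counit_bil: "cbilinear_on M (\<lambda>x y. \<epsilon> y *\<^sub>C x)"
    by (intro cbilinear_scaleC \<epsilon>_linear clinear_id)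
  have \<epsilon>a: "(\<Sum>i\<in>I. \<epsilon> (y i) *\<^sub>C x i) = a"
    using sweedler_eq[OF counit_bil I] counit_right[OF a] by simp
  have \<epsilon>b: "(\<Sum>j\<in>J. \<epsilon> (y' j) *\<^sub>C x' j) = b"
    using sweedler_eq[OF counit_bil J] counit_right[OF b] by simp
  have La: "(\<Sum>i\<in>I. \<phi> (y i) *\<^sub>C x i) = L a"
    using sweedler_eq[OF L_bilinear I] by (simp add: conv_operator_def)
  have Lb: "(\<Sum>j\<in>J. \<phi> (y' j) *\<^sub>C x' j) = L b"
    using sweedler_eq[OF L_bilinear J] by (simp add: conv_operator_def)
  have del_a: "del a = (\<Sum>i\<in>I. \<theta> (g (x i)) (\<eta> (y i)))"
    unfolding derivation_def by (rule sweedler_eq[OF derivation_bilinear I])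
  have del_b: "del b = (\<Sum>j\<in>J. \<theta> (g (x' j)) (\<eta> (y' j)))"
    unfolding derivation_def by (rule sweedler_eq[OF derivation_bilinear J])
  have "cinner (del a) (del b) = (\<Sum>i\<in>I. \<Sum>j\<in>J. ?h i j * cinner (\<eta> (y i)) (\<eta> (y' j)))"
    by (simp add: del_a del_b cinner_sum_left cinner_sum_right \<theta>_inner g_inner) (rule sum.swap)
  also have "\<dots> = (\<Sum>i\<in>I. \<Sum>j\<in>J. ?h i j * \<phi> (star (y i) * y' j))
      - (\<Sum>i\<in>I. \<Sum>j\<in>J. ?h i j * (cnj (\<epsilon> (y i)) * \<phi> (y' j)))
      - (\<Sum>i\<in>I. \<Sum>j\<in>J. ?h i j * (cnj (\<phi> (y i)) * \<epsilon> (y' j)))"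
    unfolding sum_subtractf[symmetric] using I(2) J(2)
    by (intro sum.cong refl) (simp add: \<eta>_inner algebra_simps)
  also have "(\<Sum>i\<in>I. \<Sum>j\<in>J. ?h i j * \<phi> (star (y i) * y' j)) = 0"
  proof -
    have "\<Delta> (star a * b) = (\<Sum>(i, j)\<in>I \<times> J. \<tau> (star (x i) * x' j) (star (y i) * y' j))"
      by (simp add: \<Delta>_simps(2) \<Delta>_star[OF I(3)] J(3) sum_product tensor.mult sum.cartesian_product)
    then have "(\<Sum>(i, j)\<in>I \<times> J. ?h i j *\<^sub>C (star (y i) * y' j)) = h (star a * b) *\<^sub>C 1"
      using haar_left_invariance[where a = "star a * b" and K = "I \<times> J"
          and x = "\<lambda>(i, j). star (x i) * x' j" and y = "\<lambda>(i, j). star (y i) * y' j"]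
      by (simp add: case_prod_unfold)
    then have "\<phi> (\<Sum>(i, j)\<in>I \<times> J. ?h i j *\<^sub>C (star (y i) * y' j)) = 0"
      by (simp add: clinear_on_scale[OF \<phi>_linear one_in_M] \<phi>_one)
    moreover have "\<phi> (\<Sum>k\<in>I \<times> J. ?h (fst k) (snd k) *\<^sub>C (star (y (fst k)) * y' (snd k)))
        = (\<Sum>k\<in>I \<times> J. ?h (fst k) (snd k) *\<^sub>C \<phi> (star (y (fst k)) * y' (snd k)))"
      using I(2) J(2) by (intro clinear_on_lincomb[OF \<phi>_linear M_subspace]) (auto simp: M_mult star_in_M)
    ultimately show ?thesis
      by (simp add: case_prod_unfold sum.cartesian_product)
  qed
  also have "(\<Sum>i\<in>I. \<Sum>j\<in>J. ?h i j * (cnj (\<epsilon> (y i)) * \<phi> (y' j))) = h (star a * L b)"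
    unfolding h_star_sum_mult_sum[symmetric] \<epsilon>a Lb ..
  also have "(\<Sum>i\<in>I. \<Sum>j\<in>J. ?h i j * (cnj (\<phi> (y i)) * \<epsilon> (y' j))) = h (star (L a) * b)"
    unfolding h_star_sum_mult_sum[symmetric] \<epsilon>b La ..
  also have "h (star (L a) * b) = h (star a * L b)"
    using a b by (simp flip: L_star add: L_symmetric star_in_M)
  finally show ?thesis
    by simp
qed

section \<open>The operators on the Hilbert space\<close>

abbreviation D :: "'h set" where "D \<equiv> d_dom \<tau> \<Delta> \<rho> \<xi>"
abbreviation d :: "'h \<Rightarrow> 'g" where "d \<equiv> d_op \<tau> \<Delta> \<theta> \<rho> \<xi> \<eta>"
abbreviation H :: "'h \<Rightarrow> 'h" where "H \<equiv> H_core \<tau> \<Delta> \<sigma> \<rho> \<xi> \<phi>"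

lemma in_D_iff: "v \<in> D \<longleftrightarrow> (\<exists>a\<in>M. v = g a)"
  by (auto simp: d_dom_def)

lemma D_subspace: "csubspace D"
proof (rule cvec.subspaceI)
  show "0 \<in> D"
    using M_zero clinear_on_zero[OF g_linear M_subspace] in_D_iff by metis
  show "v + w \<in> D" if "v \<in> D" "w \<in> D" for v w
    using that M_add clinear_on_add[OF g_linear[of UNIV]] unfolding in_D_iff by (metis UNIV_I)
  show "c *\<^sub>C v \<in> D" if "v \<in> D" for c v
    using that M_scale clinear_on_scale[OF g_linear[of UNIV]] unfolding in_D_iff by (metis UNIV_I)
qed

lemma linear_on_DI:
  assumes F: "clinear_on M F" and eq: "\<And>a. a \<in> M \<Longrightarrow> f (g a) = F a"
  shows "clinear_on D f"
proof (rule clinear_onI)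
  show "f (v + w) = f v + f w" if vw: "v \<in> D" "w \<in> D" for v w
  proof -
    obtain a b where "a \<in> M" "v = g a" "b \<in> M" "w = g b"
      using vw by (auto simp: in_D_iff)
    then show ?thesis
      by (simp flip: clinear_on_add[OF g_linear[of UNIV]] add: eq M_add clinear_on_add[OF F])
  qed
  show "f (c *\<^sub>C v) = c *\<^sub>C f v" if v: "v \<in> D" for c v
  proof -
    obtain a where "a \<in> M" "v = g a"
      using v by (auto simp: in_D_iff)
    then show ?thesis
      by (simp flip: clinear_on_scale[OF g_linear[of UNIV]] add: eq M_scale clinear_on_scale[OF F])
  qed
qed

lemma d_g: "a \<in> M \<Longrightarrow> d (g a) = del a"
  by (simp add: d_op_def inv_into_f_f g_inj)

lemma sym_embedding_eq: "sym_embedding \<sigma> \<rho> \<xi> a = g (\<sigma> (- \<i> / 4) a)"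
  by (simp add: sym_embedding_def gns_map_def)

text \<open>The conjugation by \<open>\<sigma>\<^bsub>-i/4\<^esub>\<close> in the definition of the core of \<open>H\<^sub>\<phi>\<close> cancels.\<close>

lemma H_g:
  assumes a: "a \<in> M"
  shows "H (g a) = - g (L a)"
proof -
  have inj: "inj_on (sym_embedding \<sigma> \<rho> \<xi>) M"
  proof (rule inj_onI)
    fix b c assume bc: "b \<in> M" "c \<in> M" "sym_embedding \<sigma> \<rho> \<xi> b = sym_embedding \<sigma> \<rho> \<xi> c"
    then have "\<sigma> (- \<i> / 4) b = \<sigma> (- \<i> / 4) c"
      using g_inj[of UNIV] by (simp add: sym_embedding_eq inj_def)
    then have "\<sigma> (\<i> / 4) (\<sigma> (- \<i> / 4) b) = \<sigma> (\<i> / 4) (\<sigma> (- \<i> / 4) c)"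
      by simp
    then show "b = c"
      using bc by (simp add: \<sigma>_\<sigma> \<sigma>_0)
  qed
  have a': "\<sigma> (\<i> / 4) a \<in> M" "\<sigma> (- \<i> / 4) (\<sigma> (\<i> / 4) a) = a"
    using a by (simp_all add: \<sigma>_in_M \<sigma>_\<sigma> \<sigma>_0)
  then have "g a = sym_embedding \<sigma> \<rho> \<xi> (\<sigma> (\<i> / 4) a)"
    by (simp add: sym_embedding_eq)
  then have "H (g a) = - sym_embedding \<sigma> \<rho> \<xi> (L (\<sigma> (\<i> / 4) a))"
    by (simp add: H_core_def inv_into_f_f[OF inj a'(1)])
  also have "\<dots> = - g (L (\<sigma> (- \<i> / 4) (\<sigma> (\<i> / 4) a)))"
    by (simp only: sym_embedding_eq L_\<sigma>_commute[OF a'(1)])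
  finally show ?thesis
    by (simp only: a'(2))
qed

lemma sym_embedding_image: "sym_embedding \<sigma> \<rho> \<xi> ` M = D"
proof -
  have "\<sigma> (- \<i> / 4) ` M = M"
  proof
    show "M \<subseteq> \<sigma> (- \<i> / 4) ` M"
    proof
      fix a assume "a \<in> M"
      then have "a = \<sigma> (- \<i> / 4) (\<sigma> (\<i> / 4) a)" "\<sigma> (\<i> / 4) a \<in> M"
        by (simp_all add: \<sigma>_\<sigma> \<sigma>_0 \<sigma>_in_M)
      then show "a \<in> \<sigma> (- \<i> / 4) ` M" by blast
    qed
  qed (auto simp: \<sigma>_in_M)
  moreover have "sym_embedding \<sigma> \<rho> \<xi> ` M = g ` \<sigma> (- \<i> / 4) ` M"
    by (simp add: image_image sym_embedding_eq)
  ultimately show ?thesis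
    by (simp add: d_dom_def)
qed

lemma H_H_g: "a \<in> M \<Longrightarrow> H (H (g a)) = g (L (L a))"
proof -
  assume a: "a \<in> M"
  have "H (H (g a)) = H (g (- L a))"
    using a clinear_on_neg[OF g_linear[of UNIV], of "L a"] by (simp add: H_g)
  also have "\<dots> = - g (L (- L a))"
    using a by (simp add: H_g L_in_M cvec.subspace_neg[OF M_subspace])
  also have "\<dots> = g (L (L a))"
    using a clinear_on_neg[OF g_linear[of UNIV], of "L (L a)"] by (simp add: L_in_M clinear_on_neg[OF L_linear])
  finally show ?thesis .
qed

lemma minus_gL_linear: "clinear_on M (\<lambda>a. - g (L a))"
  by (rule clinear_onI) (simp_all add: clinear_on_add[OF L_linear] clinear_on_scale[OF L_linear]
      clinear_on_add[OF g_linear[of UNIV]] clinear_on_scale[OF g_linear[of UNIV]])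

lemma closable_H: "closable D H"
proof (rule closableI[where K = "\<lambda>v. H (H v)", OF D_subspace])
  show "clinear_on D H"
    by (rule linear_on_DI[OF minus_gL_linear]) (rule H_g)
  fix v w assume "v \<in> D" "w \<in> D"
  then obtain a b where ab: "a \<in> M" "v = g a" "b \<in> M" "w = g b"
    by (auto simp: in_D_iff)
  have "cinner (- g (L a)) (- g (L b)) = cinner (g (L a)) (g (L b))"
    using cinner_diff_left[of 0 "g (L a)"] cinner_diff_right[of _ 0 "g (L b)"]
      cinner_commute[of 0] by simp
  also have "\<dots> = h (star a * L (L b))"
    using ab by (simp flip: L_star add: g_inner L_symmetric star_in_M L_in_M)
  also have "\<dots> = cinner v (H (H w))"
    by (simp only: ab H_H_g g_inner)
  finally show "cinner (H v) (H w) = cinner v (H (H w))"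
    using ab by (simp add: H_g)
qed

lemma inner_H: "a \<in> M \<Longrightarrow> b \<in> M \<Longrightarrow> cinner (g a) (H (g b)) = - h (star a * L b)"
  using cinner_diff_right[of "g a" 0 "g (L b)"] by (simp add: H_g g_inner)

lemma closable_d: "closable D d"
proof (rule closableI[where K = "\<lambda>v. 2 *\<^sub>C H v", OF D_subspace])
  show "clinear_on D d"
    by (rule linear_on_DI[OF derivation_linear]) (rule d_g)
  fix v w assume "v \<in> D" "w \<in> D"
  then obtain a b where "a \<in> M" "v = g a" "b \<in> M" "w = g b"
    by (auto simp: in_D_iff)
  then show "cinner (d v) (d w) = cinner v (2 *\<^sub>C H w)"
    by (simp add: d_g derivation_inner cinner_scaleC_right inner_H)
qed

lemma norm_d: "a \<in> M \<Longrightarrow> complex_of_real ((norm (d (g a)))\<^sup>2) = 2 * cinner (g a) (H (g a))"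
  by (subst cinner_self[symmetric]) (simp add: d_g derivation_inner inner_H)

lemma H_op_g: "a \<in> M \<Longrightarrow> H_op \<tau> \<Delta> \<sigma> \<rho> \<xi> \<phi> (g a) = H (g a)"
  unfolding H_op_def sym_embedding_image by (rule op_closure_eq[OF closable_H]) (auto simp: in_D_iff)

lemma dirichlet_form_g: "a \<in> M \<Longrightarrow> dirichlet_form \<tau> \<Delta> \<sigma> \<rho> \<xi> \<phi> (g a) = cinner (g a) (H (g a))"
  unfolding dirichlet_form_def sym_embedding_image
proof (rule form_closure_eq[OF closable_d, where c = "1 / 2"])
  fix v assume "v \<in> D"
  then obtain b where "b \<in> M" "v = g b"
    by (auto simp: in_D_iff)
  then show "cinner v (H v) = complex_of_real (1 / 2 * (norm (d v))\<^sup>2)"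
    using norm_d[of b] by simp
qed (auto simp: in_D_iff)

end

theorem proposition8p2:
  fixes \<tau> :: "'a::cstar_algebra \<Rightarrow> 'a \<Rightarrow> 't::cstar_algebra"
    and \<tau>l :: "'t \<Rightarrow> 'a \<Rightarrow> 't3::cstar_algebra"
    and \<tau>r :: "'a \<Rightarrow> 't \<Rightarrow> 't3"
    and \<Delta> :: "'a \<Rightarrow> 't"
    and \<epsilon> h \<phi> :: "'a \<Rightarrow> complex"
    and S :: "'a \<Rightarrow> 'a"
    and \<sigma> :: "complex \<Rightarrow> 'a \<Rightarrow> 'a"
    and \<rho> :: "'a \<Rightarrow> 'h::chilbert_space \<Rightarrow> 'h"
    and \<xi> :: 'h
    and \<pi> :: "'a \<Rightarrow> 'k::chilbert_space \<Rightarrow> 'k"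
    and \<eta> :: "'a \<Rightarrow> 'k"
    and \<theta> :: "'h \<Rightarrow> 'k \<Rightarrow> 'g::chilbert_space"
  assumes "compact_quantum_group \<tau> \<tau>l \<tau>r \<Delta>"
    and "is_counit \<tau> \<Delta> \<epsilon>"
    and "is_antipode \<tau> \<Delta> \<epsilon> S"
    and "is_haar_state \<tau> \<Delta> h"
    and "faithful_state h"
    and "gns_triple h \<rho> \<xi>"
    and "is_modular_group (hopf_core \<tau> \<Delta>) h \<sigma>"
    and "generating_functional (hopf_core \<tau> \<Delta>) \<epsilon> \<phi>"
    and "gns_symmetric (hopf_core \<tau> \<Delta>) S \<phi>"
    and "schuermann_triple (hopf_core \<tau> \<Delta>) \<epsilon> \<pi> \<eta> \<phi>"
    and "hilbert_tensor \<theta>"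
  shows "(\<forall>a\<in>hopf_core \<tau> \<Delta>.
            d_op \<tau> \<Delta> \<theta> \<rho> \<xi> \<eta> (gns_map \<rho> \<xi> a) = derivation \<tau> \<Delta> \<theta> \<rho> \<xi> \<eta> a) \<and>
         closable (d_dom \<tau> \<Delta> \<rho> \<xi>) (d_op \<tau> \<Delta> \<theta> \<rho> \<xi> \<eta>) \<and>
         (\<forall>a\<in>hopf_core \<tau> \<Delta>.
            complex_of_real ((norm (d_op \<tau> \<Delta> \<theta> \<rho> \<xi> \<eta> (gns_map \<rho> \<xi> a)))\<^sup>2) =
              2 * cinner (gns_map \<rho> \<xi> a) (H_op \<tau> \<Delta> \<sigma> \<rho> \<xi> \<phi> (gns_map \<rho> \<xi> a)) \<and>
            2 * cinner (gns_map \<rho> \<xi> a) (H_op \<tau> \<Delta> \<sigma> \<rho> \<xi> \<phi> (gns_map \<rho> \<xi> a)) =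
              2 * dirichlet_form \<tau> \<Delta> \<sigma> \<rho> \<xi> \<phi> (gns_map \<rho> \<xi> a))"
proof -
  interpret compact_quantum_group \<tau> \<tau>l \<tau>r \<Delta>
    by fact
  interpret cqg_schuermann \<tau> \<Delta> \<epsilon> h S \<phi> \<sigma> \<rho> \<xi> \<pi> \<eta> \<theta>
    by (intro cqg_schuermann.intro cqg_hopf.intro cqg_schuermann_axioms.intro tensor2 comult_hom assms)
  show ?thesis
    using closable_d d_g norm_d H_op_g dirichlet_form_g by simp
qed

end
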